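(* Let $\alpha>0$ and let $M>0$ be such that $(\|M\|,\|\alpha M\|)\in[0,\frac12]^2\setminus(0,\frac12)^2$. Then the truncated billiard orbit $B^\alpha_{[0,M]}=\{(\|x\|,\|\alpha x\|):x\in[0,M]\}$ induces a partition of $[0,\frac12]^2$ into polygons for which $$\mathcal{A}^\alpha_{[0,M]}\le 13\quad\text{and}\quad \mathcal{S}^\alpha_{[0,M]}\le 16.$$ These upper bounds are the best possible: there exist $\alpha>0$ and $M>0$ satisfying $(\|M\|,\|\alpha M\|)\in[0,\frac12]^2\setminus(0,\frac12)^2$ with $\mathcal{A}^\alpha_{[0,M]}=13$, and there exist $\alpha>0$ and $M>0$ satisfying $(\|M\|,\|\alpha M\|)\in[0,\frac12]^2\setminus(0,\frac12)^2$ with $\mathcal{S}^\alpha_{[0,M]}=16$.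
   Context: For $x\in\mathbb{R}$, $\|x\|$ denotes the distance from $x$ to the nearest integer. For $\alpha>0$ and $M>0$, $B^\alpha_{[0,M]}:=\{(\|x\|,\|\alpha x\|):x\in[0,M]\}\subset[0,\frac12]^2$ (a billiard orbit in the square $[0,\frac12]^2$ started at the corner $(0,0)$ with initial slope $\alpha$). The polygons of the partition of $[0,\frac12]^2$ induced by $B^\alpha_{[0,M]}$ are the closures of the connected components of $[0,\frac12]^2\setminus B^\alpha_{[0,M]}$. $\mathcal{A}^\alpha_{[0,M]}$ is the number of different areas of these polygons, and $\mathcal{S}^\alpha_{[0,M]}$ is the number of different shapes of these polygons, where two shapes are different if one cannot be obtained from the other by translating, rotating and reflecting. *)

theory Defs
  imports "HOL-Analysis.Analysis"
begin

definition dist_int :: "real \<Rightarrow> real" where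
  "dist_int x = \<bar>x - of_int (round x)\<bar>"

definition square :: "(real \<times> real) set" where
  "square = {0..1/2} \<times> {0..1/2}"

definition orbit_point :: "real \<Rightarrow> real \<Rightarrow> real \<times> real" where
  "orbit_point \<alpha> x = (dist_int x, dist_int (\<alpha> * x))"

definition orbit :: "real \<Rightarrow> real \<Rightarrow> (real \<times> real) set" where
  "orbit \<alpha> M = orbit_point \<alpha> ` {0..M}"

definition pieces :: "real \<Rightarrow> real \<Rightarrow> (real \<times> real) set set" where
  "pieces \<alpha> M = closure ` components (square - orbit \<alpha> M)"

(* Polygons are nondegenerate polytopes, hence convex: an orbit that ends on the boundary
   of the square consists of full chords of the square, so no other polygons occur. *)
definition polygon :: "(real \<times> real) set \<Rightarrow> bool" where
  "polygon P \<longleftrightarrow> polytope P \<and> interior P \<noteq> {}"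

(* Finiteness also makes card the true number of areas and of shapes below
   (card is 0 on infinite sets). *)
definition polygonal_partition :: "(real \<times> real) set set \<Rightarrow> (real \<times> real) set \<Rightarrow> bool" where
  "polygonal_partition \<P> S \<longleftrightarrow>
     finite \<P> \<and> (\<forall>P\<in>\<P>. polygon P) \<and> disjoint_family_on interior \<P> \<and> \<Union>\<P> = S"

definition num_areas :: "real \<Rightarrow> real \<Rightarrow> nat" where
  "num_areas \<alpha> M = card (measure lebesgue ` pieces \<alpha> M)"

(* The orthogonal maps of the plane are the rotations about the origin and the reflections
   in lines through it. *)
definition same_shape :: "(real \<times> real) set \<Rightarrow> (real \<times> real) set \<Rightarrow> bool" where
  "same_shape P Q \<longleftrightarrow> (\<exists>f a. orthogonal_transformation f \<and> Q = (\<lambda>x. a + f x) ` P)"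

definition num_shapes :: "real \<Rightarrow> real \<Rightarrow> nat" where
  "num_shapes \<alpha> M = card (pieces \<alpha> M // {(P, Q). same_shape P Q})"

definition ends_on_boundary :: "real \<Rightarrow> real \<Rightarrow> bool" where
  "ends_on_boundary \<alpha> M \<longleftrightarrow>
     orbit_point \<alpha> M \<in> square - {0<..<1/2} \<times> {0<..<1/2}"

end

theory Submission
  imports Defs
begin

text \<open>
  Exchanging the coordinates, we may assume that the orbit ends on a vertical side, i.e. \<open>M = N / 2\<close>.
  Unfolding the square then turns the orbit into the lines of slope \<open>\<plusminus>\<alpha>\<close> whose intercepts are the
  points \<open>k \<alpha> + m\<close> for \<open>N\<close> consecutive \<open>k\<close>, placed symmetrically about \<open>0\<close> (after the flip
  \<open>u \<mapsto> 1/2 - u\<close> if \<open>N\<close> is even). A polygon is cut out by one gap between consecutive intercepts for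
  each of the two slopes, and by the three gap theorem there are at most three gap lengths. Polygons
  away from the boundary are parallelograms, giving 6 shapes. A polygon that meets one side is half
  of a rhombus: 3 shapes for vertical sides and 3 of the same areas for horizontal sides. The only
  exception is one trapezoid, which arises where the orbit ends. Finally, there are three polygons at
  the corners that are not halves of rhombi. The example \<open>\<alpha> = 27/22\<close>, \<open>M = 7/2\<close>, whose gap lengths
  are \<open>2/22\<close>, \<open>3/22\<close> and \<open>5/22\<close>, attains both bounds.
\<close>

section \<open>Area of plane sets under linear maps\<close>

text \<open>Put \<open>s = v - \<alpha> * u\<close> and \<open>t = v + \<alpha> * u\<close>. The
  walls of the square become \<open>t = s\<close> (left), \<open>s + t = 0\<close> (floor),
  \<open>s + t = 1\<close> (ceiling) and \<open>t = s + \<alpha>\<close> (right). The intercept set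
  is invariant under negation and integer translation, so left wall, floor and ceiling match rising
  with falling lines exactly: if one of them cuts a cell, the two gaps of the cell are equal or
  mirror images. The right wall is the obstacle, since it asks for invariance under translation by
  \<alpha>, which fails at the points of first and last index. The cure is that first and last
  indices are opposite: an endpoint of each kind in one cell makes the sum of the two an integer
  \<open>n\<close>, the gaps are then exchanged by \<open>x \<mapsto> n - x\<close>, and the floor
  or the ceiling would have to cut the cell. What survives is a single defect, the first missing
  point after the last index. For rational \<alpha> indices are not unique and some of these events
  never happen; the counts then only drop, so all cases share one list of representatives.\<close>

definition vec2_of_pair :: "real \<times> real \<Rightarrow> real^2" where
  "vec2_of_pair p = vector [fst p, snd p]"

definition pair_of_vec2 :: "real^2 \<Rightarrow> real \<times> real" where
  "pair_of_vec2 x = (x $ 1, x $ 2)"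

lemma vec2_of_pair_nth [simp]: "vec2_of_pair p $ 1 = fst p" "vec2_of_pair p $ 2 = snd p"
  by (simp_all add: vec2_of_pair_def)

lemma pair_vec2_inverse [simp]:
  "pair_of_vec2 (vec2_of_pair p) = p" "vec2_of_pair (pair_of_vec2 x) = x"
  by (simp_all add: pair_of_vec2_def vec_eq_iff forall_2)

lemma linear_vec2_of_pair: "linear vec2_of_pair"
  by (rule linearI) (simp_all add: vec_eq_iff forall_2)

lemma linear_pair_of_vec2: "linear pair_of_vec2"
  by (rule linearI) (simp_all add: pair_of_vec2_def)

lemma measurable_vec2_of_pair [measurable]: "vec2_of_pair \<in> borel_measurable borel"
  by (intro borel_measurable_continuous_onI linear_continuous_on)
     (simp add: linear_conv_bounded_linear [symmetric] linear_vec2_of_pair)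

text \<open>Lebesgue measure is determined by its values on boxes, and boxes correspond to boxes of
  the same volume. This is the bridge that carries the determinant formula for areas from
  \<open>real^2\<close> to pairs.\<close>

lemma lborel_distr_vec2: "distr lborel borel vec2_of_pair = lborel"
proof (rule lborel_eqI [symmetric])
  fix l u :: "real^2"
  assume lu: "\<And>b. b \<in> Basis \<Longrightarrow> l \<bullet> b \<le> u \<bullet> b"
  have l: "l $ 1 \<le> u $ 1" "l $ 2 \<le> u $ 2"
    using lu[of "axis 1 1"] lu[of "axis 2 1"] by (auto simp: inner_axis)
  have "vec2_of_pair -` box l u = box (l $ 1, l $ 2) (u $ 1, u $ 2)"
    by (auto simp: mem_box_cart forall_2 mem_box Basis_prod_def)
  moreover have "(\<Prod>b\<in>Basis. (u - l) \<bullet> b) = (\<Prod>i\<in>UNIV. (u - l) $ i)"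
    by (simp add: Basis_vec_def cart_eq_inner_axis axis_eq_axis prod.UNION_disjoint)
  moreover have "emeasure lborel (box (l $ 1, l $ 2) (u $ 1, u $ 2)) = (u $ 1 - l $ 1) * (u $ 2 - l $ 2)"
  proof -
    have B: "(Basis :: (real \<times> real) set) = {(1, 0), (0, 1)}"
      by (auto simp: Basis_prod_def)
    show ?thesis
      using l by (subst emeasure_lborel_box) (auto simp: B)
  qed
  ultimately show "emeasure (distr lborel borel vec2_of_pair) (box l u) = (\<Prod>b\<in>Basis. (u - l) \<bullet> b)"
    by (simp add: emeasure_distr UNIV_2)
qed auto

lemma measure_vec2_image:
  assumes "compact S"
  shows "measure lebesgue (vec2_of_pair ` S) = measure lebesgue S"
proof -
  have c: "compact (vec2_of_pair ` S)"
    using assms linear_vec2_of_pair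
    by (intro compact_continuous_image linear_continuous_on)
       (simp add: linear_conv_bounded_linear [symmetric])
  have "measure lebesgue (vec2_of_pair ` S) = measure lborel (vec2_of_pair ` S)"
    using c by (simp add: measure_completion borel_compact)
  also have "\<dots> = measure lborel (vec2_of_pair -` vec2_of_pair ` S)"
    using c by (subst lborel_distr_vec2 [symmetric])
       (simp add: measure_distr borel_compact)
  also have "vec2_of_pair -` vec2_of_pair ` S = S"
    by (auto, metis pair_vec2_inverse(1))
  finally show ?thesis
    using assms by (simp add: measure_completion borel_compact)
qed

lemma measure_linear_image_pair:
  assumes S: "compact S"
  shows "measure lebesgue ((\<lambda>(x, y). (a * x + b * y, c * x + d * y)) ` S) =
    \<bar>a * d - b * c\<bar> * measure lebesgue S"
proof -
  define f where "f = (\<lambda>(x, y). (a * x + b * y, c * x + d * y :: real))"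
  define g where "g = vec2_of_pair \<circ> f \<circ> pair_of_vec2"
  have lf: "linear f"
    by (rule linearI) (auto simp: f_def algebra_simps)
  have lg: "linear g"
    unfolding g_def by (intro linear_compose linear_vec2_of_pair linear_pair_of_vec2 lf)
  have cf: "compact (f ` S)"
    using S lf by (intro compact_continuous_image linear_continuous_on)
       (simp_all add: linear_conv_bounded_linear [symmetric])
  have cS: "compact (vec2_of_pair ` S)"
    using S linear_vec2_of_pair
    by (intro compact_continuous_image linear_continuous_on)
       (simp add: linear_conv_bounded_linear [symmetric])
  have "det (matrix g) = a * d - b * c"
    by (simp add: det_2 matrix_def g_def f_def pair_of_vec2_def axis_def)
  moreover have "measure lebesgue (g ` vec2_of_pair ` S) =
      \<bar>det (matrix g)\<bar> * measure lebesgue (vec2_of_pair ` S)"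
    by (rule measure_linear_image [OF lg]) (simp add: lmeasurable_compact cS)
  moreover have "g ` vec2_of_pair ` S = vec2_of_pair ` f ` S"
    by (simp add: g_def image_image)
  ultimately show ?thesis
    using measure_vec2_image [OF S] measure_vec2_image [OF cf] by (simp add: f_def)
qed

lemma same_shape_measure:
  assumes "same_shape P Q" and P: "compact P"
  shows "measure lebesgue P = measure lebesgue Q"
proof -
  obtain f a where f: "orthogonal_transformation f" and Q: "Q = (\<lambda>x. a + f x) ` P"
    using assms by (auto simp: same_shape_def)
  define g where "g = vec2_of_pair \<circ> f \<circ> pair_of_vec2"
  have lf: "linear f"
    using f by (rule orthogonal_transformation_linear)
  have cf: "compact (f ` P)"
    using P lf by (intro compact_continuous_image linear_continuous_on)
       (simp_all add: linear_conv_bounded_linear [symmetric])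
  have cP: "compact (vec2_of_pair ` P)"
    using P linear_vec2_of_pair
    by (intro compact_continuous_image linear_continuous_on)
       (simp add: linear_conv_bounded_linear [symmetric])
  have n: "norm (vec2_of_pair p) = norm p" "norm (pair_of_vec2 x) = norm x" for p x
    by (simp_all add: norm_vec_def L2_set_def norm_prod_def sum_2 pair_of_vec2_def)
  have g: "orthogonal_transformation g"
    unfolding orthogonal_transformation g_def
    using f by (auto simp: n orthogonal_transformation_norm
       intro!: linear_compose linear_vec2_of_pair linear_pair_of_vec2 lf)
  have "measure lebesgue (g ` vec2_of_pair ` P) = measure lebesgue (vec2_of_pair ` P)"
    by (rule measure_orthogonal_image [OF g]) (simp add: lmeasurable_compact cP)
  moreover have "g ` vec2_of_pair ` P = vec2_of_pair ` f ` P"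
    by (simp add: g_def image_image)
  moreover have "measure lebesgue Q = measure lebesgue (f ` P)"
    using measure_translation [of a "f ` P"] by (simp add: Q image_image)
  ultimately show ?thesis
    using measure_vec2_image [OF P] measure_vec2_image [OF cf] by simp
qed

section \<open>Congruence and the possible shapes\<close>

lemma orthogonal_transformation_reflections:
  assumes "\<bar>e\<bar> = (1::real)" "\<bar>d\<bar> = (1::real)"
  shows "orthogonal_transformation (\<lambda>(u, v). (e * u, d * v))"
proof -
  have "e = 1 \<or> e = - 1"
    using assms(1) by arith
  moreover have "d = 1 \<or> d = - 1"
    using assms(2) by arith
  ultimately have ed: "e * x * (e * y) = x * y" "d * x * (d * y) = x * y" for x y
    by auto
  have "linear (\<lambda>(u, v). (e * u, d * v))"
    by (rule linearI) (auto simp: algebra_simps)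
  then show ?thesis
    by (auto simp: orthogonal_transformation_def ed)
qed

text \<open>Axis reflections and translations are the only congruences needed to match cells with
  model shapes. In this pointwise form each match becomes an equivalence of linear
  inequalities.\<close>

lemma same_shapeI:
  assumes "\<bar>e\<bar> = 1" "\<bar>d\<bar> = 1"
    and "\<And>u v. (u, v) \<in> Q \<longleftrightarrow> (e * (u - a), d * (v - b)) \<in> P"
  shows "same_shape P Q"
proof -
  have e: "e * (e * x) = x" "d * (d * x) = x" for x
    using assms(1,2) by (auto simp: abs_if split: if_splits)
  let ?h = "\<lambda>x. (a, b) + (\<lambda>(u, v). (e * u, d * v)) x"
  have "Q = ?h ` P"
  proof (intro set_eqI iffI)
    fix z assume "z \<in> Q"
    then have "(e * (fst z - a), d * (snd z - b)) \<in> P"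
      using assms(3)[of "fst z" "snd z"] by simp
    then show "z \<in> ?h ` P"
      by (rule rev_image_eqI) (simp add: e prod_eq_iff)
  next
    fix z assume "z \<in> ?h ` P"
    then obtain u v where "(u, v) \<in> P" "z = (a + e * u, b + d * v)"
      by auto
    then show "z \<in> Q"
      using assms(3)[of "a + e * u" "b + d * v"] by (simp add: e)
  qed
  then show ?thesis
    using orthogonal_transformation_reflections [OF assms(1,2)]
    unfolding same_shape_def by blast
qed

lemma same_shape_refl: "same_shape P P"
  by (rule same_shapeI [of 1 1 _ 0 0]) auto

lemma same_shape_sym:
  assumes "same_shape P Q"
  shows "same_shape Q P"
proof -
  obtain f a where f: "orthogonal_transformation f" and Q: "Q = (\<lambda>x. a + f x) ` P"
    using assms by (auto simp: same_shape_def)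
  have g: "orthogonal_transformation (inv f)"
    using f by (rule orthogonal_transformation_inv)
  have i: "inv f (f x) = x" for x
    using f by (simp add: orthogonal_transformation_inj)
  have "P = (\<lambda>x. - inv f a + inv f x) ` Q"
    using linear_add [OF orthogonal_transformation_linear [OF g]]
    by (simp add: Q image_image i)
  then show ?thesis
    using g unfolding same_shape_def by blast
qed

lemma same_shape_trans:
  assumes "same_shape P Q" "same_shape Q R"
  shows "same_shape P R"
proof -
  obtain f a where f: "orthogonal_transformation f" and Q: "Q = (\<lambda>x. a + f x) ` P"
    using assms by (auto simp: same_shape_def)
  obtain g b where g: "orthogonal_transformation g" and R: "R = (\<lambda>x. b + g x) ` Q"
    using assms by (auto simp: same_shape_def)
  have "R = (\<lambda>x. (b + g a) + (g \<circ> f) x) ` P"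
    using linear_add [OF orthogonal_transformation_linear [OF g]]
    by (simp add: Q R image_image add.assoc)
  then show ?thesis
    using orthogonal_transformation_compose [OF g f] unfolding same_shape_def by blast
qed

lemma same_shape_compact:
  assumes "same_shape P Q" "compact P"
  shows "compact Q"
proof -
  obtain f a where f: "orthogonal_transformation f" and Q: "Q = (\<lambda>x. a + f x) ` P"
    using assms by (auto simp: same_shape_def)
  have "bounded_linear f"
    using orthogonal_transformation_linear [OF f] by (simp add: linear_conv_bounded_linear)
  then show ?thesis
    unfolding Q using assms(2)
    by (intro compact_continuous_image continuous_intros) (rule linear_continuous_on)
qed

text \<open>A second invariant besides area, needed because wall and floor triangles over the same
  gap have equal areas.\<close>

lemma same_shape_diameter:
  assumes "same_shape P Q"
  shows "diameter P = diameter Q"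
proof -
  obtain f a where f: "orthogonal_transformation f" and Q: "Q = (\<lambda>x. a + f x) ` P"
    using assms by (auto simp: same_shape_def)
  have "dist (f x) (f y) = dist x y" for x y
    using f by (simp add: dist_norm orthogonal_transformation_norm
        linear_diff [OF orthogonal_transformation_linear [OF f], symmetric])
  moreover have "Q \<times> Q = (\<lambda>z. (a + f (fst z), a + f (snd z))) ` (P \<times> P)"
    unfolding Q by force
  ultimately have "(\<lambda>z. dist (fst z) (snd z)) ` (Q \<times> Q) = (\<lambda>z. dist (fst z) (snd z)) ` (P \<times> P)"
    by (simp add: image_image)
  then show ?thesis
    by (simp add: diameter_def Q case_prod_unfold)
qed

section \<open>Areas by dissection, and the model shapes\<close>

lemma measure_Un_line:
  assumes "compact A" "compact B" "(p, q) \<noteq> (0, 0)"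
    and "A \<inter> B \<subseteq> {(u, v). p * u + q * v = (r::real)}"
  shows "measure lebesgue (A \<union> B) = measure lebesgue A + measure lebesgue B"
proof -
  have "negligible {x. (p, q) \<bullet> x = r}"
    using assms(3) by (intro negligible_hyperplane) (auto simp: zero_prod_def)
  moreover have "{x. (p, q) \<bullet> x = r} = {(u, v). p * u + q * v = r}"
    by auto
  ultimately have "negligible (A \<inter> B)"
    using assms(4) negligible_subset by metis
  then have "measure lebesgue (A \<inter> B) = 0"
    by (simp add: negligible_iff_measure)
  then show ?thesis
    using assms(1,2) by (simp add: measure_Un3 lmeasurable_compact)
qed

lemma measure_two_halves:
  assumes "same_shape A B" "compact A" "(p, q) \<noteq> (0, 0)"
    and "A \<inter> B \<subseteq> {(u, v). p * u + q * v = (r::real)}"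
  shows "measure lebesgue (A \<union> B) = 2 * measure lebesgue A"
  using measure_Un_line [OF assms(2) same_shape_compact [OF assms(1,2)] assms(3,4)]
    same_shape_measure [OF assms(1,2)] by simp

text \<open>The rectangle \<open>[0, x] \<times> [0, y]\<close> in the coordinates
  \<open>v - \<alpha> * u\<close> and \<open>v + \<alpha> * u\<close>; \<open>x\<close> and
  \<open>y\<close> stand for gap lengths. For \<open>x = y\<close> it is a rhombus, whose vertical
  diagonal cuts off \<open>wall_triangle\<close>, whose horizontal diagonal cuts off (up to
  translation) \<open>floor_triangle\<close>, and a quarter of which is
  \<open>corner_triangle\<close>.\<close>

definition parallelogram :: "real \<Rightarrow> real \<Rightarrow> real \<Rightarrow> (real \<times> real) set" where
  "parallelogram \<alpha> x y =
    {(u, v). 0 \<le> v - \<alpha> * u \<and> v - \<alpha> * u \<le> x \<and> 0 \<le> v + \<alpha> * u \<and> v + \<alpha> * u \<le> y}"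

definition wall_triangle :: "real \<Rightarrow> real \<Rightarrow> (real \<times> real) set" where
  "wall_triangle \<alpha> x = {(u, v). 0 \<le> u \<and> 0 \<le> v - \<alpha> * u \<and> v + \<alpha> * u \<le> x}"

definition floor_triangle :: "real \<Rightarrow> real \<Rightarrow> (real \<times> real) set" where
  "floor_triangle \<alpha> x = {(u, v). 0 \<le> v \<and> v - \<alpha> * u \<le> 0 \<and> v + \<alpha> * u \<le> x}"

definition corner_triangle :: "real \<Rightarrow> real \<Rightarrow> (real \<times> real) set" where
  "corner_triangle \<alpha> x = {(u, v). 0 \<le> u \<and> 0 \<le> v \<and> v + \<alpha> * u \<le> x / 2}"

text \<open>For \<open>0 \<le> w \<le> x\<close> this is what a falling line leaves of
  \<open>wall_triangle \<alpha> x\<close> after cutting off the similar triangle of size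
  \<open>x - w\<close>.\<close>

definition trapezoid :: "real \<Rightarrow> real \<Rightarrow> real \<Rightarrow> (real \<times> real) set" where
  "trapezoid \<alpha> x w = {(u, v). 0 \<le> u \<and> 0 \<le> v - \<alpha> * u \<and> x - w \<le> v + \<alpha> * u \<and> v + \<alpha> * u \<le> x}"

lemmas shape_defs = parallelogram_def wall_triangle_def floor_triangle_def
  corner_triangle_def trapezoid_def

context
  fixes \<alpha> :: real
  assumes pos: "\<alpha> > 0"
begin

text \<open>The map inverts \<open>(u, v) \<mapsto> (v - \<alpha> * u, v + \<alpha> * u)\<close>;
  its determinant \<open>- 1 / (2 * \<alpha>)\<close> is the source of the factor in all areas
  below.\<close>

lemma parallelogram_eq_image:
  "parallelogram \<alpha> x y =
    (\<lambda>(s, t). ((- 1 / (2 * \<alpha>)) * s + (1 / (2 * \<alpha>)) * t, (1 / 2) * s + (1 / 2) * t))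
      ` cbox (0, 0) (x, y)" (is "_ = ?L ` _")
proof (intro set_eqI iffI)
  fix z assume "z \<in> parallelogram \<alpha> x y"
  then obtain u v where z: "z = (u, v)" "0 \<le> v - \<alpha> * u" "v - \<alpha> * u \<le> x"
    "0 \<le> v + \<alpha> * u" "v + \<alpha> * u \<le> y"
    by (auto simp: parallelogram_def)
  have "z = ?L (v - \<alpha> * u, v + \<alpha> * u)"
    using pos by (auto simp: z field_simps)
  then show "z \<in> ?L ` cbox (0, 0) (x, y)"
    using z(2-) by (intro image_eqI [of _ _ "(v - \<alpha> * u, v + \<alpha> * u)"]) (auto simp: mem_box Basis_prod_def)
next
  fix z assume "z \<in> ?L ` cbox (0, 0) (x, y)"
  then obtain s t where z: "z = ?L (s, t)" and st: "0 \<le> s" "s \<le> x" "0 \<le> t" "t \<le> y"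
    by (auto simp: Basis_prod_def mem_box)
  have "\<alpha> * ((- 1 / (2 * \<alpha>)) * s + (1 / (2 * \<alpha>)) * t) = (t - s) / 2"
    using pos by (simp add: field_simps)
  then show "z \<in> parallelogram \<alpha> x y"
    using st by (simp add: z parallelogram_def field_simps)
qed

lemma compact_parallelogram: "compact (parallelogram \<alpha> x y)"
  unfolding parallelogram_eq_image
  by (intro compact_continuous_image compact_cbox) (use pos in \<open>auto intro!: continuous_intros simp: case_prod_unfold\<close>)

lemma measure_parallelogram:
  assumes "0 \<le> x" "0 \<le> y"
  shows "measure lebesgue (parallelogram \<alpha> x y) = x * y / (2 * \<alpha>)"
proof -
  have "measure lebesgue (cbox (0, 0) (x, y)) = x * y"
    using assms by (simp add: content_Pair)
  then show ?thesis
    unfolding parallelogram_eq_image measure_linear_image_pair [OF compact_cbox]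
    using pos by simp
qed

lemma compact_shapes:
  "compact (wall_triangle \<alpha> x)" "compact (floor_triangle \<alpha> x)"
  "compact (corner_triangle \<alpha> x)" "compact (trapezoid \<alpha> x w)"
proof -
  have c: "compact S" if "closed S" and sub: "\<And>u v. (u, v) \<in> S \<Longrightarrow>
      - x \<le> v - \<alpha> * u \<and> v - \<alpha> * u \<le> x \<and> - x \<le> v + \<alpha> * u \<and> v + \<alpha> * u \<le> x" for S
  proof -
    \<comment> \<open>Raised by \<open>x\<close>, the region where both coordinates lie in
      \<open>[- x, x]\<close> is a rhombus of gap length \<open>2 * x\<close>, already known to be
      compact.\<close>
    have "same_shape (parallelogram \<alpha> (2 * x) (2 * x)) {(u, v). (u, v + x) \<in> parallelogram \<alpha> (2 * x) (2 * x)}"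
      by (rule same_shapeI [of 1 1 _ 0 "- x"]) auto
    then have "compact {(u, v). (u, v + x) \<in> parallelogram \<alpha> (2 * x) (2 * x)}"
      using compact_parallelogram same_shape_compact by blast
    moreover have "S \<subseteq> {(u, v). (u, v + x) \<in> parallelogram \<alpha> (2 * x) (2 * x)}"
      by (auto simp: parallelogram_def dest!: sub)
    ultimately show ?thesis
      using \<open>closed S\<close> by (metis compact_Int_closed inf.absorb2)
  qed
  have nn: "0 \<le> u \<Longrightarrow> 0 \<le> \<alpha> * u" for u
    using pos by simp
  have cl: "closed (wall_triangle \<alpha> x)" "closed (floor_triangle \<alpha> x)"
    "closed (corner_triangle \<alpha> x)" "closed (trapezoid \<alpha> x w)"
    unfolding shape_defs case_prod_unfold
    by (intro closed_Collect_conj closed_Collect_le continuous_intros)+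
  show "compact (wall_triangle \<alpha> x)"
  proof (rule c [OF cl(1)])
    fix u v assume "(u, v) \<in> wall_triangle \<alpha> x"
    then show "- x \<le> v - \<alpha> * u \<and> v - \<alpha> * u \<le> x \<and> - x \<le> v + \<alpha> * u \<and> v + \<alpha> * u \<le> x"
      using nn [of u] by (simp add: wall_triangle_def)
  qed
  show "compact (floor_triangle \<alpha> x)"
  proof (rule c [OF cl(2)])
    fix u v assume "(u, v) \<in> floor_triangle \<alpha> x"
    then show "- x \<le> v - \<alpha> * u \<and> v - \<alpha> * u \<le> x \<and> - x \<le> v + \<alpha> * u \<and> v + \<alpha> * u \<le> x"
      using nn [of u] by (simp add: floor_triangle_def)
  qed
  show "compact (corner_triangle \<alpha> x)"
  proof (rule c [OF cl(3)])
    fix u v assume "(u, v) \<in> corner_triangle \<alpha> x"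
    then show "- x \<le> v - \<alpha> * u \<and> v - \<alpha> * u \<le> x \<and> - x \<le> v + \<alpha> * u \<and> v + \<alpha> * u \<le> x"
      using nn [of u] by (simp add: corner_triangle_def)
  qed
  show "compact (trapezoid \<alpha> x w)"
  proof (rule c [OF cl(4)])
    fix u v assume "(u, v) \<in> trapezoid \<alpha> x w"
    then show "- x \<le> v - \<alpha> * u \<and> v - \<alpha> * u \<le> x \<and> - x \<le> v + \<alpha> * u \<and> v + \<alpha> * u \<le> x"
      using nn [of u] by (simp add: trapezoid_def)
  qed
qed

text \<open>The mirror image in the vertical side completes the triangle to the rhombus; the next
  two areas arise in the same way, each by one reflection in the horizontal axis.\<close>

lemma measure_wall_triangle:
  assumes "0 \<le> x"
  shows "measure lebesgue (wall_triangle \<alpha> x) = x\<^sup>2 / (4 * \<alpha>)"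
proof -
  let ?B = "{(u, v). (- u, v) \<in> wall_triangle \<alpha> x}"
  have "parallelogram \<alpha> x x = wall_triangle \<alpha> x \<union> ?B"
  proof -
    have "(u, v) \<in> parallelogram \<alpha> x x \<longleftrightarrow> (u, v) \<in> wall_triangle \<alpha> x \<union> ?B" for u v
    proof -
      have "0 \<le> u \<Longrightarrow> 0 \<le> \<alpha> * u" "u \<le> 0 \<Longrightarrow> \<alpha> * u \<le> 0"
        using pos by (simp_all add: mult_le_0_iff)
      then show ?thesis
        by (cases "0 \<le> u") (auto simp: parallelogram_def wall_triangle_def)
    qed
    then show ?thesis
      by auto
  qed
  moreover have "measure lebesgue (wall_triangle \<alpha> x \<union> ?B) = 2 * measure lebesgue (wall_triangle \<alpha> x)"
    by (rule measure_two_halves [OF _ compact_shapes(1), where p = 1 and q = 0 and r = 0])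
       (auto simp: wall_triangle_def intro!: same_shapeI [of "- 1" 1 _ 0 0])
  ultimately show ?thesis
    using measure_parallelogram [OF assms assms] by (simp add: power2_eq_square)
qed

lemma measure_floor_triangle:
  assumes "0 \<le> x"
  shows "measure lebesgue (floor_triangle \<alpha> x) = x\<^sup>2 / (4 * \<alpha>)"
proof -
  let ?B = "{(u, v). (u, - v) \<in> floor_triangle \<alpha> x}"
  have "same_shape (parallelogram \<alpha> x x) (floor_triangle \<alpha> x \<union> ?B)"
    using pos
    by (intro same_shapeI [of 1 1 _ "x / (2 * \<alpha>)" "- x / 2"]) (auto simp: shape_defs algebra_simps)
  moreover have "measure lebesgue (floor_triangle \<alpha> x \<union> ?B) = 2 * measure lebesgue (floor_triangle \<alpha> x)"
    by (rule measure_two_halves [OF _ compact_shapes(2), where p = 0 and q = 1 and r = 0])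
       (auto simp: floor_triangle_def intro!: same_shapeI [of 1 "- 1" _ 0 0])
  ultimately show ?thesis
    using measure_parallelogram [OF assms assms] same_shape_measure [OF _ compact_parallelogram, of x x]
    by (simp add: power2_eq_square)
qed

lemma measure_corner_triangle:
  assumes "0 \<le> x"
  shows "measure lebesgue (corner_triangle \<alpha> x) = x\<^sup>2 / (8 * \<alpha>)"
proof -
  let ?B = "{(u, v). (u, - v) \<in> corner_triangle \<alpha> x}"
  have "same_shape (wall_triangle \<alpha> x) (corner_triangle \<alpha> x \<union> ?B)"
    using pos
    by (intro same_shapeI [of 1 1 _ 0 "- x / 2"]) (auto simp: shape_defs algebra_simps)
  then have "measure lebesgue (wall_triangle \<alpha> x) = measure lebesgue (corner_triangle \<alpha> x \<union> ?B)"
    using compact_shapes by (intro same_shape_measure)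
  moreover have "measure lebesgue (corner_triangle \<alpha> x \<union> ?B) = 2 * measure lebesgue (corner_triangle \<alpha> x)"
    by (rule measure_two_halves [OF _ compact_shapes(3), where p = 0 and q = 1 and r = 0])
       (auto simp: corner_triangle_def intro!: same_shapeI [of 1 "- 1" _ 0 0])
  ultimately show ?thesis
    using measure_wall_triangle [OF assms] by simp
qed

lemma measure_trapezoid:
  assumes "0 \<le> w" "w \<le> x"
  shows "measure lebesgue (trapezoid \<alpha> x w) = (x\<^sup>2 - (x - w)\<^sup>2) / (4 * \<alpha>)"
proof -
  have "wall_triangle \<alpha> x = trapezoid \<alpha> x w \<union> wall_triangle \<alpha> (x - w)"
    using assms by (auto simp: shape_defs)
  moreover have "measure lebesgue (trapezoid \<alpha> x w \<union> wall_triangle \<alpha> (x - w)) =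
    measure lebesgue (trapezoid \<alpha> x w) + measure lebesgue (wall_triangle \<alpha> (x - w))"
    by (rule measure_Un_line [OF compact_shapes(4) compact_shapes(1), where p = \<alpha> and q = 1 and r = "x - w"])
       (auto simp: shape_defs)
  ultimately show ?thesis
    using measure_wall_triangle [of x] measure_wall_triangle [of "x - w"] assms
    by (simp add: diff_divide_distrib)
qed

end

section \<open>Partitions of the square and its isometries\<close>

text \<open>Each member of \<open>A\<close> is relatively open and, as the complement of the union
  of the others, relatively closed. A connected component cannot leave such a set.\<close>

lemma components_relatively_open_unique:
  assumes disj: "pairwise disjnt A" and un: "\<Union>A = S"
    and A: "\<And>X. X \<in> A \<Longrightarrow> openin (top_of_set S) X \<and> connected X \<and> X \<noteq> {}"
  shows "components S = A"
proof -
  have *: "connected_component_set S x = X" if X: "X \<in> A" "x \<in> X" for x X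
  proof
    show "X \<subseteq> connected_component_set S x"
      using X A un by (intro connected_component_maximal) auto
    let ?C = "connected_component_set S x"
    have "openin (top_of_set S) (\<Union>(A - {X}))"
      using A by (intro openin_Union) auto
    moreover have "S - X = \<Union>(A - {X})" "X \<subseteq> S"
      using un disj X by (fastforce simp: pairwise_def disjnt_def)+
    ultimately have "closedin (top_of_set S) X"
      by (simp add: closedin_def)
    then obtain K where K: "closed K" "X = S \<inter> K"
      by (auto simp: closedin_closed)
    obtain U where U: "open U" "X = S \<inter> U"
      using A X by (meson openin_open)
    have C: "?C \<subseteq> S" "connected ?C"
      by (simp_all add: connected_component_subset)
    then have "?C \<inter> X = ?C \<inter> U" "?C \<inter> X = ?C \<inter> K"
      using K U by auto
    then have "openin (top_of_set ?C) (?C \<inter> X)" "closedin (top_of_set ?C) (?C \<inter> X)"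
      using K U by (metis openin_open_Int, metis closedin_closed_Int)
    moreover have "x \<in> ?C \<inter> X"
      using X un by (auto simp: connected_component_refl)
    ultimately show "?C \<subseteq> X"
      using C(2) unfolding connected_clopen by blast
  qed
  show ?thesis
  proof (intro set_eqI iffI)
    fix C assume "C \<in> components S"
    then obtain x where "x \<in> S" "C = connected_component_set S x"
      by (auto simp: components_iff)
    then show "C \<in> A"
      using * un by (metis UnionE)
  next
    fix C assume C: "C \<in> A"
    then obtain x where "x \<in> C"
      using A by blast
    then show "C \<in> components S"
      using * [OF C] C un by (auto simp: components_iff)
  qed
qed

lemma components_homeomorphic_image:
  assumes "homeomorphism S T h k"
  shows "components T = image h ` components S"
proof -
  have *: "h ` C \<in> components T" if C: "C \<in> components S" and hk: "homeomorphism S T h k" for S T C h k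
  proof -
    have CS: "C \<subseteq> S" "connected C" "C \<noteq> {}"
      using in_components_subset [OF C] in_components_connected [OF C] in_components_nonempty [OF C]
      by auto
    have inv: "\<And>x. x \<in> S \<Longrightarrow> k (h x) = x" "\<And>y. y \<in> T \<Longrightarrow> h (k y) = y"
      using hk by (auto simp: homeomorphism_def)
    have "h ` C \<subseteq> T"
      using CS hk by (auto simp: homeomorphism_def)
    moreover have "connected (h ` C)"
      using CS hk by (meson connected_continuous_image continuous_on_subset homeomorphism_def)
    moreover have "D = h ` C" if D: "D \<noteq> {}" "h ` C \<subseteq> D" "D \<subseteq> T" "connected D" for D
    proof -
      have "connected (k ` D)"
        using D hk by (meson connected_continuous_image continuous_on_subset homeomorphism_def)
      moreover have "k ` D \<subseteq> S"
        using D hk by (auto simp: homeomorphism_def)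
      moreover have "C \<subseteq> k ` D"
      proof
        fix x assume "x \<in> C"
        then show "x \<in> k ` D"
          using CS D inv(1) by (intro image_eqI [of _ _ "h x"]) auto
      qed
      ultimately have "k ` D = C"
        using CS components_maximal [OF C, of "k ` D"] by blast
      moreover have "h ` k ` D = D"
        using D(3) inv(2) by (force simp: image_image)
      ultimately show ?thesis
        by simp
    qed
    ultimately show ?thesis
      using CS unfolding in_components_maximal by blast
  qed
  show ?thesis
  proof (intro set_eqI iffI)
    fix D assume D: "D \<in> components T"
    then have "k ` D \<in> components S"
      using * assms homeomorphism_sym by blast
    moreover have "h (k y) = y" if "y \<in> D" for y
      using that in_components_subset [OF D] assms by (auto simp: homeomorphism_def)
    then have "D = h ` k ` D"
      by (simp add: image_image)
    ultimately show "D \<in> image h ` components S"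
      by blast
  qed (use * [OF _ assms] in auto)
qed

text \<open>Freed from the orbit, so that it applies to sets of lines and to mirror images of the
  orbit.\<close>

definition pieces_of :: "(real \<times> real) set \<Rightarrow> (real \<times> real) set set" where
  "pieces_of X = closure ` components (square - X)"

lemma square_eq_cbox: "square = cbox (0, 0) (1 / 2, 1 / 2)"
  by (auto simp: square_def)

lemma polygonal_partition_cells:
  assumes fin: "finite \<C>" and disj: "pairwise disjnt \<C>" and un: "\<Union>\<C> = square - X"
    and cell: "\<And>C. C \<in> \<C> \<Longrightarrow> convex C \<and> C \<noteq> {} \<and> polytope (closure C) \<and> (\<exists>U. open U \<and> C = square \<inter> U)"
    and neg: "negligible X"
  shows "components (square - X) = \<C>" "polygonal_partition (closure ` \<C>) square"
proof -
  show "components (square - X) = \<C>"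
  proof (rule components_relatively_open_unique [OF disj un])
    fix C assume C: "C \<in> \<C>"
    then obtain U where U: "open U" "C = square \<inter> U"
      using cell by blast
    then have "C = (square - X) \<inter> U"
      using un C by blast
    then show "openin (top_of_set (square - X)) C \<and> connected C \<and> C \<noteq> {}"
      using cell [OF C] U convex_connected by (auto intro!: openin_open_Int)
  qed
  have sq: "closure (interior square) = square" "closed square"
    by (simp_all add: square_eq_cbox interior_cbox closure_box box_ne_empty flip: box_eq_empty)
       (auto simp: closure_box box_eq_empty Basis_prod_def)
  \<comment> \<open>A cell is open only relative to the square, but the open square is dense in it,
    so a cell cannot consist of boundary points alone.\<close>
  have int: "interior C \<noteq> {}" if C: "C \<in> \<C>" for C
  proof -
    obtain U where U: "open U" "C = square \<inter> U"
      using cell C by blast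
    have "closure (interior square) \<inter> U \<noteq> {}"
      using cell C U sq by auto
    then have "interior square \<inter> U \<noteq> {}"
      using U(1) by (simp add: open_Int_closure_eq_empty Int_commute)
    then show ?thesis
      using U by (simp add: interior_open)
  qed
  \<comment> \<open>For convex sets, closing does not enlarge the interior; hence disjoint cells
    keep disjoint interiors after closing.\<close>
  have ic: "interior (closure C) = interior C" if "C \<in> \<C>" for C
    using cell that by (simp add: convex_interior_closure)
  \<comment> \<open>A null set contains no nonempty open set, so removing \<open>X\<close> leaves a
    dense part of the square.\<close>
  have dense: "square \<subseteq> closure (square - X)"
  proof -
    have "closure (interior square) \<subseteq> closure (square - X)"
    proof (rule closure_minimal [rotated])
      show "interior square \<subseteq> closure (square - X)"
      proof (rule ccontr)
        assume "\<not> ?thesis"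
        then have ne: "interior square - closure (square - X) \<noteq> {}"
          by blast
        have "interior square - closure (square - X) \<subseteq> X"
          using closure_subset [of "square - X"] interior_subset [of square] by blast
        then have "negligible (interior square - closure (square - X))"
          using neg negligible_subset by blast
        then show False
          using ne by (simp add: open_not_negligible open_Diff)
      qed
    qed auto
    then show ?thesis
      using sq by simp
  qed
  have "\<Union>(closure ` \<C>) = closure (\<Union>\<C>)"
  proof
    show "\<Union>(closure ` \<C>) \<subseteq> closure (\<Union>\<C>)"
      by (intro UN_least closure_mono) blast
    have "\<Union>\<C> \<subseteq> \<Union>(closure ` \<C>)"
      using closure_subset by fastforce
    then show "closure (\<Union>\<C>) \<subseteq> \<Union>(closure ` \<C>)"
      using fin by (intro closure_minimal closed_UN) auto
  qed
  also have "\<dots> = square"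
    using un dense sq(2) by (metis Diff_subset closure_minimal subset_antisym)
  finally have cover: "\<Union>(closure ` \<C>) = square" .
  have "disjoint_family_on interior (closure ` \<C>)"
    unfolding disjoint_family_on_def
  proof (intro ballI impI)
    fix P Q assume "P \<in> closure ` \<C>" "Q \<in> closure ` \<C>" "P \<noteq> Q"
    then obtain C D where CD: "C \<in> \<C>" "P = closure C" "D \<in> \<C>" "Q = closure D" "C \<noteq> D"
      by blast
    then have "C \<inter> D = {}"
      using disj by (auto simp: pairwise_def disjnt_def)
    then show "interior P \<inter> interior Q = {}"
      using CD ic interior_subset by blast
  qed
  then show "polygonal_partition (closure ` \<C>) square"
    unfolding polygonal_partition_def polygon_def using fin cell int ic cover by auto
qed

text \<open>Two instances occur: the flip \<open>u \<mapsto> 1/2 - u\<close> for even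
  \<open>N\<close>, and the exchange of coordinates for orbits that end on a horizontal
  side.\<close>

locale square_isometry =
  fixes f :: "real \<times> real \<Rightarrow> real \<times> real" and a and h
  assumes f: "orthogonal_transformation f"
    and h: "h = (\<lambda>x. a + f x)"
    and h_square: "h ` square = square"
begin

lemma linear_f: "linear f" and inj_f: "inj f"
  using f by (auto simp: orthogonal_transformation_linear orthogonal_transformation_inj)

lemma inj_h: "inj h"
  using inj_f by (auto simp: h inj_def)

lemma image_h: "h ` S = (+) a ` f ` S"
  by (simp add: h image_image)

lemma closure_h: "closure (h ` S) = h ` closure S"
  by (simp add: image_h closure_translation closure_injective_linear_image [OF linear_f inj_f])

lemma interior_h: "interior (h ` S) = h ` interior S"
  by (simp add: image_h interior_translation interior_injective_linear_image [OF linear_f inj_f])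

lemma homeomorphism_h: "\<exists>k. homeomorphism S (h ` S) h k"
proof -
  obtain g where g: "linear g" "g \<circ> f = id"
    using linear_injective_left_inverse [OF linear_f inj_f] by blast
  then have gf: "g (f x) = x" for x
    by (metis comp_apply id_apply)
  have cont: "continuous_on A f" "continuous_on A g" for A
    using linear_f g(1) by (simp_all add: linear_continuous_on linear_conv_bounded_linear)
  have "homeomorphism S (h ` S) h (\<lambda>x. g (x - a))"
    unfolding homeomorphism_def h
    by (auto simp: gf image_image intro!: continuous_intros cont continuous_on_compose2 [OF cont(2)])
  then show ?thesis
    by blast
qed

lemma pieces_of_image: "pieces_of (h ` X) = image h ` pieces_of X"
proof -
  have "square - h ` X = h ` (square - X)"
    using inj_h h_square by (metis image_set_diff)
  moreover have "components (h ` (square - X)) = image h ` components (square - X)"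
    using homeomorphism_h components_homeomorphic_image by blast
  ultimately show ?thesis
    by (simp add: pieces_of_def image_image closure_h)
qed

lemma same_shape_image: "same_shape P (h ` P)"
  using f unfolding same_shape_def h by blast

lemma polygonal_partition_image:
  assumes "polygonal_partition \<P> square"
  shows "polygonal_partition (image h ` \<P>) square"
proof -
  have "polytope (h ` P)" if "polytope P" for P
    using that linear_f by (simp add: image_h polytope_translation_eq polytope_linear_image)
  moreover have "h ` interior P \<inter> h ` interior Q = {}" if "P \<in> \<P>" "Q \<in> \<P>" "h ` P \<noteq> h ` Q" for P Q
  proof -
    have "P \<noteq> Q"
      using that(3) by blast
    then have "interior P \<inter> interior Q = {}"
      using that(1,2) assms unfolding polygonal_partition_def disjoint_family_on_def by blast
    then show ?thesis
      using inj_h by (metis image_Int image_empty)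
  qed
  moreover have "\<Union>(image h ` \<P>) = square"
    using assms h_square by (metis polygonal_partition_def image_Union)
  ultimately show ?thesis
    using assms unfolding polygonal_partition_def polygon_def disjoint_family_on_def
    by (auto simp: interior_h)
qed

end

lemma square_isometry_flip:
  "square_isometry (\<lambda>(u, v). (- u, v)) (1 / 2, 0) (\<lambda>(u, v). (1 / 2 - u, v))"
proof
  show "orthogonal_transformation (\<lambda>(u, v). (- u, v) :: real \<times> real)"
    using orthogonal_transformation_reflections [of "- 1" 1] by simp
  show "(\<lambda>(u, v). (1 / 2 - u, v)) ` square = square"
  proof (intro set_eqI iffI)
    fix z assume "z \<in> square"
    then show "z \<in> (\<lambda>(u, v). (1 / 2 - u, v)) ` square"
      by (intro image_eqI [of _ _ "(1 / 2 - fst z, snd z)"]) (auto simp: square_def)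
  qed (auto simp: square_def)
qed auto

lemma square_isometry_swap: "square_isometry prod.swap (0, 0) prod.swap"
proof
  show "orthogonal_transformation (prod.swap :: real \<times> real \<Rightarrow> _)"
    by (auto simp: orthogonal_transformation_def intro!: linearI)
  show "prod.swap ` square = square"
    by (auto simp: square_def)
qed (auto simp: zero_prod_def [symmetric])

section \<open>Gaps between intercepts\<close>

locale orbit_lines =
  fixes \<alpha> :: real and N :: nat
  assumes slope_pos: "\<alpha> > 0" and N_pos: "N > 0"
begin

text \<open>The index \<open>k\<close> is centred at \<open>(N - 1) / 2\<close> to make the
  intercepts symmetric about \<open>0\<close>. It ranges over all integers because the indices
  \<open>-1\<close> and \<open>N\<close>, just outside \<open>intercepts\<close>, mark where
  translation by \<alpha> fails.\<close>

definition pt :: "int \<Rightarrow> int \<Rightarrow> real" where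
  "pt k m = (of_int k - (real N - 1) / 2) * \<alpha> + of_int m"

definition intercepts :: "real set" where
  "intercepts = {pt k m | k m. 0 \<le> k \<and> k < int N}"

definition gap :: "real \<Rightarrow> real \<Rightarrow> bool" where
  "gap a b \<longleftrightarrow> a < b \<and> a \<in> intercepts \<and> b \<in> intercepts \<and> intercepts \<inter> {a<..<b} = {}"

lemma pt_Suc: "pt k m + \<alpha> = pt (k + 1) m" and pt_pred: "pt k m - \<alpha> = pt (k - 1) m"
  and pt_shift: "pt k m + of_int n = pt k (m + n)"
  and pt_uminus: "- pt k m = pt (int N - 1 - k) (- m)"
  by (simp_all add: pt_def algebra_simps add_divide_distrib diff_divide_distrib)

lemma intercepts_shift: "x + of_int n \<in> intercepts \<longleftrightarrow> x \<in> intercepts"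
proof -
  have *: "x + of_int n \<in> intercepts" if "x \<in> intercepts" for x n
    using that unfolding intercepts_def by (smt (verit, best) mem_Collect_eq pt_shift)
  then show ?thesis
    using *[of x n] *[of "x + of_int n" "- n"] by auto
qed

lemma intercepts_uminus: "- x \<in> intercepts \<longleftrightarrow> x \<in> intercepts"
proof -
  have *: "- x \<in> intercepts" if x: "x \<in> intercepts" for x
  proof -
    obtain k m where "x = pt k m" "0 \<le> k" "k < int N"
      using x by (auto simp: intercepts_def)
    then have "- x = pt (int N - 1 - k) (- m)" "0 \<le> int N - 1 - k" "int N - 1 - k < int N"
      using pt_uminus by auto
    then show ?thesis
      unfolding intercepts_def by blast
  qed
  show ?thesis
    using *[of x] *[of "- x"] by auto
qed

lemma pt_in_intercepts: "0 \<le> k \<Longrightarrow> k < int N \<Longrightarrow> pt k m \<in> intercepts"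
  by (auto simp: intercepts_def)

text \<open>Phrased through membership instead of indices, since for rational \<alpha> a point may
  have several indices. If \<open>x + \<alpha>\<close> is missing, any admissible index of
  \<open>x\<close> must be the last one.\<close>

lemma leaving_intercepts:
  assumes "x \<in> intercepts" "x + \<alpha> \<notin> intercepts"
  obtains m where "x = pt (int N - 1) m"
proof -
  obtain k m where x: "x = pt k m" "0 \<le> k" "k < int N"
    using assms(1) by (auto simp: intercepts_def)
  then have "\<not> k + 1 < int N"
    using assms(2) pt_in_intercepts [of "k + 1" m] by (auto simp: pt_Suc)
  then have "k = int N - 1"
    using x by linarith
  then show ?thesis
    using x that by blast
qed

lemma entering_intercepts:
  assumes "x \<in> intercepts" "x - \<alpha> \<notin> intercepts"
  obtains m where "x = pt 0 m"
proof -
  obtain k m where x: "x = pt k m" "0 \<le> k" "k < int N"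
    using assms(1) by (auto simp: intercepts_def)
  have "\<not> 1 \<le> k"
  proof
    assume "1 \<le> k"
    then have "pt (k - 1) m \<in> intercepts"
      using x by (intro pt_in_intercepts) auto
    then show False
      using assms(2) x by (simp add: pt_pred)
  qed
  with x(2) have "k = 0"
    by linarith
  then show ?thesis
    using x that by blast
qed

section \<open>Existence, uniqueness and symmetries of gaps\<close>

lemma finite_intercepts: "finite (intercepts \<inter> {x..y})"
proof -
  define B where "B k = (of_int k - (real N - 1) / 2) * \<alpha>" for k :: int
  have "intercepts \<inter> {x..y} \<subseteq> (\<Union>k\<in>{0..<int N}. (\<lambda>m. pt k m) ` {\<lfloor>x - B k\<rfloor>..\<lceil>y - B k\<rceil>})"
  proof
    fix z assume "z \<in> intercepts \<inter> {x..y}"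
    then obtain k m where z: "z = pt k m" "k \<in> {0..<int N}" "x \<le> B k + of_int m" "B k + of_int m \<le> y"
      by (auto simp: intercepts_def pt_def B_def)
    then have "\<lfloor>x - B k\<rfloor> \<le> m" "m \<le> \<lceil>y - B k\<rceil>"
      by linarith+
    then show "z \<in> (\<Union>k\<in>{0..<int N}. (\<lambda>m. pt k m) ` {\<lfloor>x - B k\<rfloor>..\<lceil>y - B k\<rceil>})"
      using z(1,2) by (intro UN_I [of k] image_eqI [of _ _ m]) auto
  qed
  then show ?thesis
    by (rule finite_subset) auto
qed

lemma intercept_within_1: "\<exists>y\<in>intercepts. x \<le> y \<and> y < x + 1"
proof -
  have "pt 0 \<lceil>x - pt 0 0\<rceil> = pt 0 0 + \<lceil>x - pt 0 0\<rceil>"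
    by (simp add: pt_def)
  moreover have "pt 0 \<lceil>x - pt 0 0\<rceil> \<in> intercepts"
    using N_pos by (simp add: pt_in_intercepts)
  ultimately show ?thesis
    by (intro bexI [of _ "pt 0 \<lceil>x - pt 0 0\<rceil>"]) linarith+
qed

lemma gap_exists:
  assumes x: "x \<notin> intercepts"
  obtains a b where "gap a b" "a < x" "x < b"
proof -
  let ?A = "intercepts \<inter> {x - 1..x}" and ?B = "intercepts \<inter> {x..x + 1}"
  have A: "finite ?A" "?A \<noteq> {}" and B: "finite ?B" "?B \<noteq> {}"
    using finite_intercepts intercept_within_1 [of "x - 1"] intercept_within_1 [of x]
    by (auto intro: less_imp_le)
  define a where "a = Max ?A"
  define b where "b = Min ?B"
  have a: "a \<in> ?A" "\<And>z. z \<in> ?A \<Longrightarrow> z \<le> a" and b: "b \<in> ?B" "\<And>z. z \<in> ?B \<Longrightarrow> b \<le> z"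
    unfolding a_def b_def
    by (fact Max_in [OF A], fact Max_ge [OF A(1)], fact Min_in [OF B], fact Min_le [OF B(1)])
  then have "a < x" "x < b"
    using x by (auto simp: less_le)
  moreover have "z \<notin> intercepts" if "z \<in> {a<..<b}" for z
  proof
    assume z: "z \<in> intercepts"
    show False
    proof (cases "z \<le> x")
      case True
      then have "z \<in> ?A" using z a(1) that by auto
      then show False using a(2) that by force
    next
      case False
      then have "z \<in> ?B" using z b(1) that by auto
      then show False using b(2) that by force
    qed
  qed
  ultimately show ?thesis
    using that [of a b] a(1) b(1) unfolding gap_def by force
qed

lemma gapD: "gap a b \<Longrightarrow> a < b" "gap a b \<Longrightarrow> a \<in> intercepts" "gap a b \<Longrightarrow> b \<in> intercepts"
  "gap a b \<Longrightarrow> a < x \<Longrightarrow> x < b \<Longrightarrow> x \<notin> intercepts"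
  by (auto simp: gap_def)

text \<open>The tool by which a single overlap identifies a gap with another gap, or with its
  reflection or translate.\<close>

lemma gap_unique:
  assumes "gap a b" "gap c d" "a < d" "c < b"
  shows "a = c" "b = d"
  using gapD [OF assms(1)] gapD [OF assms(2)] assms(3,4) by (metis linorder_neqE)+

lemma gap_shift: "gap a b \<Longrightarrow> gap (a + of_int n) (b + of_int n)"
  unfolding gap_def
proof (intro conjI; elim conjE)
  assume *: "intercepts \<inter> {a<..<b} = {}"
  have "x \<notin> intercepts" if "a + of_int n < x" "x < b + of_int n" for x
    using * that intercepts_shift [of "x - of_int n" n] by force
  then show "intercepts \<inter> {a + of_int n<..<b + of_int n} = {}"
    by auto
qed (simp_all add: intercepts_shift)

lemma gap_uminus: "gap a b \<Longrightarrow> gap (- b) (- a)"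
  unfolding gap_def
proof (intro conjI; elim conjE)
  assume *: "intercepts \<inter> {a<..<b} = {}"
  have "x \<notin> intercepts" if "- b < x" "x < - a" for x
    using * that intercepts_uminus [of x] by force
  then show "intercepts \<inter> {- b<..<- a} = {}"
    by auto
qed (simp_all add: intercepts_uminus)

lemma gap_reflect: "gap a b \<Longrightarrow> gap (of_int n - b) (of_int n - a)"
  using gap_shift [OF gap_uminus, of a b n] by simp

lemma gap_le_1: "gap a b \<Longrightarrow> b \<le> a + 1"
  using gapD(2) [of a b] gapD(4) [of a b "a + 1"] intercepts_shift [of a 1] by force

definition lo :: "real \<Rightarrow> real" where
  "lo x = (THE a. \<exists>b. gap a b \<and> a < x \<and> x < b)"

definition hi :: "real \<Rightarrow> real" where
  "hi x = (THE b. \<exists>a. gap a b \<and> a < x \<and> x < b)"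

lemma lo_hi:
  assumes "gap a b" "a < x" "x < b"
  shows "lo x = a" "hi x = b"
  unfolding lo_def hi_def using assms gap_unique
  by (intro the_equality; (metis less_trans)?; blast?)+

text \<open>Translating a gap by \<open>\<alpha>\<close> gives a gap again, until an endpoint has the last index or
  the translate would contain the first point. Each of these three events pins down one gap modulo 1.\<close>

lemma three_gaps:
  obtains l\<^sub>1 l\<^sub>2 l\<^sub>3 where "\<And>a b. gap a b \<Longrightarrow> b - a \<in> {l\<^sub>1, l\<^sub>2, l\<^sub>3}"
proof -
  \<comment> \<open>The three lengths belong to the gap to the right of the last point, the gap to
    its left, and the gap around the point of index \<open>-1\<close>, whose translate by \<alpha>
    contains the first point.\<close>
  let ?p = "pt (int N - 1) 0"
  define l\<^sub>1 where "l\<^sub>1 = (THE l. gap ?p (?p + l))"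
  define l\<^sub>2 where "l\<^sub>2 = (THE l. gap (?p - l) ?p)"
  define l\<^sub>3 where "l\<^sub>3 = hi (pt (- 1) 0) - lo (pt (- 1) 0)"
  have pt0: "pt k m = pt k 0 + of_int m" for k m
    by (simp add: pt_def)
  have l\<^sub>1: "b - a = l\<^sub>1" if "gap a b" "a = pt (int N - 1) m" for a b m
  proof -
    have "gap ?p (?p + (b - a))"
      using gap_shift [OF that(1), of "- m"] that(2) pt0 [of "int N - 1" m] by simp
    moreover have "l = l'" if "gap ?p (?p + l)" "gap ?p (?p + l')" for l l'
      using gap_unique [OF that] gapD [OF that(1)] gapD [OF that(2)] by simp
    ultimately show ?thesis
      unfolding l\<^sub>1_def by (metis (mono_tags, lifting) the_equality)
  qed
  have l\<^sub>2: "b - a = l\<^sub>2" if "gap a b" "b = pt (int N - 1) m" for a b m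
  proof -
    have "gap (?p - (b - a)) ?p"
      using gap_shift [OF that(1), of "- m"] that(2) pt0 [of "int N - 1" m] by simp
    moreover have "l = l'" if "gap (?p - l) ?p" "gap (?p - l') ?p" for l l'
      using gap_unique [OF that] gapD [OF that(1)] gapD [OF that(2)] by simp
    ultimately show ?thesis
      unfolding l\<^sub>2_def by (metis (mono_tags, lifting) the_equality)
  qed
  have l\<^sub>3: "b - a = l\<^sub>3" if "gap a b" "a < pt (- 1) m" "pt (- 1) m < b" for a b m
  proof -
    have "gap (a - of_int m) (b - of_int m)"
      using gap_shift [OF that(1), of "- m"] by simp
    then have "lo (pt (- 1) 0) = a - of_int m" "hi (pt (- 1) 0) = b - of_int m"
      using that(2,3) pt0 [of "- 1" m] lo_hi [of "a - of_int m" "b - of_int m" "pt (- 1) 0"] by auto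
    then show ?thesis
      by (simp add: l\<^sub>3_def)
  qed
  \<comment> \<open>The induction variable \<open>j\<close> counts the translations by \<alpha>
    after which the left endpoint has the last index.\<close>
  have *: "b - a \<in> {l\<^sub>1, l\<^sub>2, l\<^sub>3}" if "gap a b" "a = pt k m" "0 \<le> k" "k < int N" "j = nat (int N - 1 - k)" for a b k m j
    using that
  proof (induction j arbitrary: a b k)
    case 0
    then have "k = int N - 1"
      by linarith
    then show ?case
      using l\<^sub>1 [OF 0(1), of m] 0(2) by auto
  next
    case (Suc j)
    note g = gapD [OF Suc.prems(1)]
    show ?case
    proof (cases "b + \<alpha> \<in> intercepts")
      case False
      then obtain n where "b = pt (int N - 1) n"
        using leaving_intercepts [OF g(3)] by blast
      then show ?thesis
        using l\<^sub>2 [OF Suc.prems(1)] by auto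
    next
      case True
      have a': "a + \<alpha> = pt (k + 1) m" "0 \<le> k + 1" "k + 1 < int N" "j = nat (int N - 1 - (k + 1))"
        using Suc.prems by (auto simp: pt_Suc)
      show ?thesis
      proof (cases "gap (a + \<alpha>) (b + \<alpha>)")
        case True
        then show ?thesis
          using Suc.IH [OF True a'] by simp
      next
        case False
        moreover have "a + \<alpha> \<in> intercepts"
          using a' pt_in_intercepts by simp
        ultimately obtain z where z: "z \<in> intercepts" "a + \<alpha> < z" "z < b + \<alpha>"
          using True g(1) by (auto simp: gap_def)
        \<comment> \<open>A point \<open>z\<close> inside the translated gap has no predecessor,
          since that would lie inside the original gap; so \<open>z\<close> has index
          \<open>0\<close>.\<close>
        then have "z - \<alpha> \<notin> intercepts"
          using g(4) [of "z - \<alpha>"] by simp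
        then obtain n where "z = pt 0 n"
          using entering_intercepts z(1) by blast
        then show ?thesis
          using l\<^sub>3 [OF Suc.prems(1), of n] z pt_pred [of 0 n] by simp
      qed
    qed
  qed
  have "b - a \<in> {l\<^sub>1, l\<^sub>2, l\<^sub>3}" if g: "gap a b" for a b
  proof -
    obtain k m where "a = pt k m" "0 \<le> k" "k < int N"
      using gapD(2) [OF g] by (auto simp: intercepts_def)
    then show ?thesis
      using * [OF g] by blast
  qed
  then show ?thesis
    using that by blast
qed

end

section \<open>Classification of the cells\<close>

context orbit_lines
begin

text \<open>The bounds \<open>a\<close>, \<open>b\<close> are for the intercepts of rising lines,
  \<open>c\<close>, \<open>d\<close> for those of falling lines. Comparing \<open>b\<close> with
  \<open>c\<close>, \<open>d\<close> with \<open>a + \<alpha>\<close>, \<open>a + c\<close> with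
  \<open>0\<close> and \<open>b + d\<close> with \<open>1\<close> tells whether the left, right,
  bottom or top wall cuts the cell.\<close>

definition ccell :: "real \<Rightarrow> real \<Rightarrow> real \<Rightarrow> real \<Rightarrow> (real \<times> real) set" where
  "ccell a b c d = {(u, v). (u, v) \<in> square \<and> a \<le> v - \<alpha> * u \<and> v - \<alpha> * u \<le> b \<and>
     c \<le> v + \<alpha> * u \<and> v + \<alpha> * u \<le> d}"

lemma scale_iffs: "0 \<le> u \<longleftrightarrow> 0 \<le> \<alpha> * u" "u \<le> 1 / 2 \<longleftrightarrow> 2 * (\<alpha> * u) \<le> \<alpha>"
  using slope_pos mult_le_cancel_left_pos [of \<alpha> u "1 / 2"] by (simp_all add: zero_le_mult_iff mult.commute)

text \<open>Only \<open>\<alpha> * u\<close> and \<open>v\<close> occur on the right, so that linear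
  arithmetic can treat the product as an atom.\<close>

lemma ccell_iff:
  "(u, v) \<in> ccell a b c d \<longleftrightarrow> 0 \<le> \<alpha> * u \<and> 2 * (\<alpha> * u) \<le> \<alpha> \<and> 0 \<le> v \<and> 2 * v \<le> 1 \<and>
    a \<le> v - \<alpha> * u \<and> v - \<alpha> * u \<le> b \<and> c \<le> v + \<alpha> * u \<and> v + \<alpha> * u \<le> d"
  using scale_iffs [of u] by (auto simp: ccell_def square_def)

lemma scale_shift: "\<alpha> * (u - z / \<alpha>) = \<alpha> * u - z"
  using slope_pos by (simp add: right_diff_distrib)

text \<open>The hypotheses say that no wall cuts the cell; the offset moves the lowest vertex, where
  the coordinates are \<open>a\<close> and \<open>c\<close>, to the origin.\<close>

lemma ccell_parallelogram:
  assumes "b \<le> c" "d \<le> a + \<alpha>" "0 \<le> a + c" "b + d \<le> 1"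
  shows "same_shape (parallelogram \<alpha> (b - a) (d - c)) (ccell a b c d)"
proof (rule same_shapeI [of 1 1 _ "(c - a) / 2 / \<alpha>" "(a + c) / 2"])
  fix u v
  show "(u, v) \<in> ccell a b c d \<longleftrightarrow> (1 * (u - (c - a) / 2 / \<alpha>), 1 * (v - (a + c) / 2)) \<in> parallelogram \<alpha> (b - a) (d - c)"
    unfolding ccell_iff parallelogram_def mem_Collect_eq split_conv mult_1 scale_shift
    using assms by (auto simp: field_simps)
qed auto

text \<open>The mirror image exchanges the two gap lengths, so unordered pairs of lengths suffice: 6
  shapes instead of 9.\<close>

lemma ccell_parallelogram':
  assumes "b \<le> c" "d \<le> a + \<alpha>" "0 \<le> a + c" "b + d \<le> 1"
  shows "same_shape (parallelogram \<alpha> (d - c) (b - a)) (ccell a b c d)"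
proof (rule same_shapeI [of "- 1" 1 _ "(c - a) / 2 / \<alpha>" "(a + c) / 2"])
  fix u v
  have neg: "\<alpha> * (- 1 * w) = - (\<alpha> * w)" for w
    by simp
  show "(u, v) \<in> ccell a b c d \<longleftrightarrow> (- 1 * (u - (c - a) / 2 / \<alpha>), 1 * (v - (a + c) / 2)) \<in> parallelogram \<alpha> (d - c) (b - a)"
    unfolding ccell_iff parallelogram_def mem_Collect_eq split_conv mult_1 neg scale_shift
    using assms by (auto simp: field_simps)
qed auto

lemma ccell_left_wall:
  assumes "b \<le> a + \<alpha>" "0 \<le> a" "b \<le> 1 / 2"
  shows "same_shape (wall_triangle \<alpha> (b - a)) (ccell a b a b)"
proof (rule same_shapeI [of 1 1 _ 0 a])
  fix u v
  show "(u, v) \<in> ccell a b a b \<longleftrightarrow> (1 * (u - 0), 1 * (v - a)) \<in> wall_triangle \<alpha> (b - a)"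
    unfolding ccell_iff wall_triangle_def mem_Collect_eq split_conv mult_1 diff_0_right scale_iffs(1) [of u]
    using assms by (auto simp: field_simps)
qed auto

lemma ccell_floor:
  assumes "b \<le> 0" "b - a \<le> 1" "- a \<le> a + \<alpha>"
  shows "same_shape (floor_triangle \<alpha> (b - a)) (ccell a b (- b) (- a))"
proof (rule same_shapeI [of 1 1 _ "(- b) / \<alpha>" 0])
  fix u v
  show "(u, v) \<in> ccell a b (- b) (- a) \<longleftrightarrow> (1 * (u - (- b) / \<alpha>), 1 * (v - 0)) \<in> floor_triangle \<alpha> (b - a)"
    unfolding ccell_iff floor_triangle_def mem_Collect_eq split_conv mult_1 scale_shift
    using assms by (auto simp: field_simps)
qed auto

lemma ccell_ceiling:
  assumes "b \<le> 1 / 2" "b - a \<le> 1" "1 - a \<le> a + \<alpha>"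
  shows "same_shape (floor_triangle \<alpha> (b - a)) (ccell a b (1 - b) (1 - a))"
proof (rule same_shapeI [of 1 "- 1" _ "(1 / 2 - b) / \<alpha>" "1 / 2"])
  fix u v
  show "(u, v) \<in> ccell a b (1 - b) (1 - a) \<longleftrightarrow>
      (1 * (u - (1 / 2 - b) / \<alpha>), - 1 * (v - 1 / 2)) \<in> floor_triangle \<alpha> (b - a)"
    unfolding ccell_iff floor_triangle_def mem_Collect_eq split_conv mult_1 scale_shift
    using assms by (auto simp: field_simps)
qed auto

lemma scale_right: "\<alpha> * (- 1 * (u - 1 / 2)) = \<alpha> / 2 - \<alpha> * u"
  by (simp add: algebra_simps)

lemma scale_right_iff: "0 \<le> - 1 * (u - 1 / 2) \<longleftrightarrow> 2 * (\<alpha> * u) \<le> \<alpha>"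
  using scale_iffs(2) [of u] by auto

text \<open>Shifted down by \<alpha>, the falling gap neither starts nor ends before the rising one,
  so besides the wall only the rising line at \<open>b\<close> and the falling line at
  \<open>c\<close> bound the cell.\<close>

lemma ccell_right_wall:
  assumes "b \<le> c" "a + \<alpha> \<le> c" "b + \<alpha> \<le> d" "0 \<le> a + c" "b + d \<le> 1"
  shows "same_shape (wall_triangle \<alpha> (b + \<alpha> - c)) (ccell a b c d)"
proof (rule same_shapeI [of "- 1" 1 _ "1 / 2" "c - \<alpha> / 2"])
  fix u v
  show "(u, v) \<in> ccell a b c d \<longleftrightarrow>
      (- 1 * (u - 1 / 2), 1 * (v - (c - \<alpha> / 2))) \<in> wall_triangle \<alpha> (b + \<alpha> - c)"
    unfolding ccell_iff wall_triangle_def mem_Collect_eq split_conv scale_right scale_right_iff mult_1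
    using assms by (auto simp: field_simps)
qed auto

text \<open>On the wall, \<open>[a, b]\<close> and \<open>[c - \<alpha>, d - \<alpha>]\<close> share
  their upper end, but the rising line at \<open>a\<close> cuts off a triangle of size
  \<open>a + \<alpha> - c\<close>. In \<open>ccell_trapezoid_above\<close> they share the lower end,
  which costs one more reflection.\<close>

lemma ccell_trapezoid_below:
  assumes "b \<le> c" "c \<le> a + \<alpha>" "b + \<alpha> = d" "0 \<le> a + c" "b + d \<le> 1"
  shows "same_shape (trapezoid \<alpha> (d - c) (d - (a + \<alpha>))) (ccell a b c d)"
proof (rule same_shapeI [of "- 1" 1 _ "1 / 2" "c - \<alpha> / 2"])
  fix u v
  show "(u, v) \<in> ccell a b c d \<longleftrightarrow>
      (- 1 * (u - 1 / 2), 1 * (v - (c - \<alpha> / 2))) \<in> trapezoid \<alpha> (d - c) (d - (a + \<alpha>))"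
    unfolding ccell_iff trapezoid_def mem_Collect_eq split_conv scale_right scale_right_iff mult_1
    using assms by (auto simp: field_simps)
qed auto

lemma ccell_trapezoid_above:
  assumes "b \<le> c" "a + \<alpha> = c" "d \<le> b + \<alpha>" "0 \<le> a + c" "b + d \<le> 1"
  shows "same_shape (trapezoid \<alpha> (b - a) (d - c)) (ccell a b c d)"
proof (rule same_shapeI [of "- 1" "- 1" _ "1 / 2" "b + \<alpha> / 2"])
  fix u v
  show "(u, v) \<in> ccell a b c d \<longleftrightarrow>
      (- 1 * (u - 1 / 2), - 1 * (v - (b + \<alpha> / 2))) \<in> trapezoid \<alpha> (b - a) (d - c)"
    unfolding ccell_iff trapezoid_def mem_Collect_eq split_conv scale_right scale_right_iff
    using assms by (auto simp: field_simps)
qed auto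

section \<open>Corners and the right wall\<close>

lemma even_intercept: "even N \<Longrightarrow> \<alpha> / 2 \<in> intercepts"
proof -
  assume "even N"
  then obtain n where n: "N = 2 * n"
    by blast
  then have "pt (int n) 0 \<in> intercepts"
    using N_pos by (intro pt_in_intercepts) auto
  moreover have "pt (int n) 0 = \<alpha> / 2"
    unfolding pt_def by (simp add: n field_simps)
  ultimately show ?thesis
    by simp
qed

lemma odd_intercept: "odd N \<Longrightarrow> 0 \<in> intercepts"
proof -
  assume "odd N"
  then obtain n where n: "N = 2 * n + 1"
    using oddE by blast
  then have "pt (int n) 0 \<in> intercepts"
    by (intro pt_in_intercepts) auto
  moreover have "pt (int n) 0 = 0"
    unfolding pt_def by (simp add: n)
  ultimately show ?thesis
    by simp
qed

text \<open>A right-hand corner cell is determined by the gap of its falling lines, a left-hand one by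
  the gap common to both directions. Since \<open>0\<close> is an intercept for odd \<open>N\<close> and \<open>\<alpha> / 2\<close> is one for
  even \<open>N\<close>, one of the two bottom corners is a vertex of the orbit, which leaves three corner cells.\<close>

definition corner_cells :: "(real \<times> real) set list" where
  "corner_cells =
    [if even N then ccell (lo 0) (hi 0) (lo 0) (hi 0)
       else ccell (- hi (\<alpha> / 2)) (- lo (\<alpha> / 2)) (lo (\<alpha> / 2)) (hi (\<alpha> / 2)),
     ccell (lo (1 / 2)) (hi (1 / 2)) (lo (1 / 2)) (hi (1 / 2)),
     ccell (1 - hi ((1 + \<alpha>) / 2)) (1 - lo ((1 + \<alpha>) / 2)) (lo ((1 + \<alpha>) / 2)) (hi ((1 + \<alpha>) / 2))]"

text \<open>A rising line of last index reaches the right wall at a height where the reflected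
  falling line would have an intercept \<open>pt (int N) m\<close>. That line is missing unless the
  point happens to be an intercept, and the gap around it gives the exceptional cell.\<close>

definition cut_triangle :: "(real \<times> real) set" where
  "cut_triangle = trapezoid \<alpha> (hi (pt (int N) 0) - lo (pt (int N) 0)) (hi (pt (int N) 0) - pt (int N) 0)"

text \<open>A pair of gaps that is symmetric about a half-integer, but not about the bottom or the top
  of the square, belongs to no cell.\<close>

lemma symmetric_gaps_outside:
  assumes "gap a b" "gap c d" "0 \<le> a + c" "b + d \<le> 1" "b + c = of_int n \<or> a + d = of_int n"
  shows False
  using assms(5)
proof
  assume n: "b + c = of_int n"
  then have "d = of_int n - a"
    using gap_unique(2) [OF gap_reflect [OF assms(1), of n] assms(2)] gapD(1) [OF assms(1)]
      gapD(1) [OF assms(2)] by linarith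
  \<comment> \<open>Here \<open>a + c = n - (b - a)\<close> and \<open>b + d = n + (b - a)\<close>,
    so the two bounds leave no integer \<open>n\<close>.\<close>
  then have "0 < n" "n < 1"
    using n assms(3,4) gapD(1) [OF assms(1)] by linarith+
  then show False
    by simp
next
  assume n: "a + d = of_int n"
  then have "c = of_int n - b"
    using gap_unique(1) [OF gap_reflect [OF assms(1), of n] assms(2)] gapD(1) [OF assms(1)]
      gapD(1) [OF assms(2)] by linarith
  then have "0 < n" "n < 1"
    using n assms(3,4) gapD(1) [OF assms(1)] by linarith+
  then show False
    by simp
qed

text \<open>The centred coefficients of first and last index cancel. Thus a cell with one endpoint
  of each kind meets the integrality hypothesis of \<open>symmetric_gaps_outside\<close>.\<close>

lemma pt_first_last: "pt (int N - 1) m + pt 0 n = of_int (m + n)"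
  using N_pos by (simp add: pt_def field_simps)

lemma pt_last_diff: "pt k m - pt k n = of_int (m - n)"
  by (simp add: pt_def)

lemma pt_N: "pt (int N) m = pt (int N) 0 + of_int m"
  by (simp add: pt_def)

lemma cut_triangle_eq:
  assumes "gap c d" "c < pt (int N) m" "pt (int N) m < d"
  shows "cut_triangle = trapezoid \<alpha> (d - c) (d - pt (int N) m)"
proof -
  have "lo (pt (int N) 0) = c - of_int m" "hi (pt (int N) 0) = d - of_int m"
    using lo_hi [OF gap_shift [OF assms(1), of "- m"], of "pt (int N) 0"] assms(2,3)
    by (auto simp: pt_N [of m])
  then have "hi (pt (int N) 0) - lo (pt (int N) 0) = d - c"
    "hi (pt (int N) 0) - pt (int N) 0 = d - pt (int N) m"
    using pt_N [of m] by linarith+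
  then show ?thesis
    by (simp only: cut_triangle_def)
qed

text \<open>The wall \<open>u = 1/2\<close> is where the orbit ends: there the intercepts are cut off differently for
  the two directions, and the only new shape is the triangle cut by the last line.\<close>

lemma right_wall_cells:
  assumes I: "gap a b" and J: "gap c d"
    and ineq: "b \<le> c" "0 \<le> a + c" "b + d \<le> 1" "a + \<alpha> < d" "c < b + \<alpha>"
  shows "same_shape cut_triangle (ccell a b c d) \<or>
    same_shape (wall_triangle \<alpha> (b - a)) (ccell a b c d) \<or>
    same_shape (wall_triangle \<alpha> (d - c)) (ccell a b c d)"
proof -
  note gI = gapD [OF I] and gJ = gapD [OF J]
  \<comment> \<open>Translated rising endpoints strictly inside the falling gap are no intercepts,
    so they come from the last index; dually, falling endpoints whose predecessors lie inside the
    rising gap have index \<open>0\<close>.\<close>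
  have last_a: "\<exists>m. a = pt (int N - 1) m" if "c < a + \<alpha>"
    using leaving_intercepts [OF gI(2)] gJ(4) [of "a + \<alpha>"] that ineq by blast
  have last_b: "\<exists>m. b = pt (int N - 1) m" if "b + \<alpha> < d"
    using leaving_intercepts [OF gI(3)] gJ(4) [of "b + \<alpha>"] that ineq by blast
  have first_c: "\<exists>m. c = pt 0 m" if "a + \<alpha> < c"
    using entering_intercepts [OF gJ(2)] gI(4) [of "c - \<alpha>"] that ineq
    by (metis less_diff_eq diff_less_eq)
  have first_d: "\<exists>m. d = pt 0 m" if "d < b + \<alpha>"
    using entering_intercepts [OF gJ(3)] gI(4) [of "d - \<alpha>"] that ineq
    by (metis less_diff_eq diff_less_eq)
  consider (triangle) "a + \<alpha> \<le> c" "b + \<alpha> \<le> d" | (below) "c < a + \<alpha>" "b + \<alpha> \<le> d"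
    | (above) "a + \<alpha> \<le> c" "d < b + \<alpha>" | (both) "c < a + \<alpha>" "d < b + \<alpha>"
    by linarith
  then show ?thesis
  proof cases
    case triangle
    show ?thesis
    proof (cases "a + \<alpha> = c \<or> b + \<alpha> = d")
      case True
      then have "b + \<alpha> - c = b - a \<or> b + \<alpha> - c = d - c"
        by auto
      then show ?thesis
        using ccell_right_wall [OF ineq(1) triangle ineq(2,3)] by metis
    next
      case False
      then obtain m n where "c = pt 0 m" "b = pt (int N - 1) n"
        using first_c last_b triangle by force
      then have "b + c = of_int (n + m)"
        by (simp only: pt_first_last)
      then show ?thesis
        using symmetric_gaps_outside [OF I J] ineq by blast
    qed
  next
    case below
    obtain m where m: "a = pt (int N - 1) m"
      using last_a below by blast
    have "b + \<alpha> = d"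
    proof (rule ccontr)
      assume "b + \<alpha> \<noteq> d"
      then obtain n where "b = pt (int N - 1) n"
        using last_b below by force
      \<comment> \<open>Two points of the same index differ by an integer, which would make the
        strictly longer gap from \<open>c\<close> to \<open>d\<close> exceed length
        \<open>1\<close>.\<close>
      then have "b - a = of_int (n - m)"
        by (simp only: m pt_last_diff)
      then have "1 \<le> b - a"
        using gI(1) by (metis diff_gt_0_iff_gt of_int_0_less_iff of_int_1_le_iff zless_imp_add1_zle add_0)
      then show False
        using gap_le_1 [OF J] below \<open>b + \<alpha> \<noteq> d\<close> by linarith
    qed
    moreover have "a + \<alpha> = pt (int N) m"
      by (simp add: m pt_Suc)
    ultimately show ?thesis
      using ccell_trapezoid_below [of b c a d] cut_triangle_eq [OF J, of m] below ineq by simp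
  next
    case above
    obtain m where m: "d = pt 0 m"
      using first_d above by blast
    have eq: "a + \<alpha> = c"
    proof (rule ccontr)
      assume "a + \<alpha> \<noteq> c"
      then obtain n where "c = pt 0 n"
        using first_c above by force
      then have "d - c = of_int (m - n)"
        by (simp only: m pt_last_diff)
      then have "1 \<le> d - c"
        using gJ(1) by (metis diff_gt_0_iff_gt of_int_0_less_iff of_int_1_le_iff zless_imp_add1_zle add_0)
      then show False
        using gap_le_1 [OF I] above \<open>a + \<alpha> \<noteq> c\<close> by linarith
    qed
    \<comment> \<open>Negation turns this case into the previous one: the missing point now lies in
      the reflected gap from \<open>- b\<close> to \<open>- a\<close>.\<close>
    have p: "pt (int N) (- m) = \<alpha> - d"
      using pt_uminus [of "- 1" m] pt_pred [of 0 m] by (simp add: m)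
    have "cut_triangle = trapezoid \<alpha> (- a - (- b)) (- a - pt (int N) (- m))"
      using above ineq eq by (intro cut_triangle_eq gap_uminus I) (auto simp: p)
    then have "cut_triangle = trapezoid \<alpha> (b - a) (d - c)"
      using eq by (simp add: p algebra_simps)
    then show ?thesis
      using ccell_trapezoid_above [of b c a d] above eq ineq by simp
  next
    case both
    then obtain m n where "a = pt (int N - 1) m" "d = pt 0 n"
      using last_a first_d by blast
    then have "a + d = of_int (m + n)"
      by (simp only: pt_first_last)
    then show ?thesis
      using symmetric_gaps_outside [OF I J] ineq by blast
  qed
qed

text \<open>The numbers \<open>s\<close>, \<open>t\<close> are the sheared coordinates of a point of
  the cell inside the open square. The case split is over the walls that cut the cell: none gives a
  parallelogram, one gives half a rhombus or the exceptional cell, and two adjacent ones give a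
  corner cell.\<close>

lemma cell_shapes:
  assumes I: "gap a b" and J: "gap c d"
    and s: "a < s" "s < b" and t: "c < t" "t < d"
    and st: "s < t" "t < s + \<alpha>" "0 < s + t" "s + t < 1"
  shows "same_shape (parallelogram \<alpha> (b - a) (d - c)) (ccell a b c d) \<and>
      same_shape (parallelogram \<alpha> (d - c) (b - a)) (ccell a b c d) \<or>
    same_shape (wall_triangle \<alpha> (b - a)) (ccell a b c d) \<or>
    same_shape (wall_triangle \<alpha> (d - c)) (ccell a b c d) \<or>
    same_shape (floor_triangle \<alpha> (b - a)) (ccell a b c d) \<or>
    same_shape cut_triangle (ccell a b c d) \<or>
    ccell a b c d \<in> set corner_cells"
proof -
  note gI = gapD [OF I] and gJ = gapD [OF J]
  \<comment> \<open>A cell cut by the left wall has overlapping, hence equal, gaps. For floor and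
    ceiling the same is applied after reflecting the rising gap about \<open>0\<close> and
    \<open>1/2\<close>.\<close>
  have L: "b \<le> c \<or> a = c \<and> b = d"
  proof (cases "b \<le> c")
    case False
    then have *: "a < d" "c < b"
      using s t st by linarith+
    show ?thesis
      using gap_unique [OF I J *] by auto
  qed simp
  have B: "0 \<le> a + c \<or> c = - b \<and> d = - a"
  proof (cases "0 \<le> a + c")
    case False
    then have *: "- b < d" "c < - a"
      using s t st by linarith+
    show ?thesis
      using gap_unique [OF gap_uminus [OF I] J *] by auto
  qed simp
  have I': "gap (1 - b) (1 - a)"
    using gap_reflect [OF I, of 1] by simp
  have T: "b + d \<le> 1 \<or> c = 1 - b \<and> d = 1 - a"
  proof (cases "b + d \<le> 1")
    case False
    then have *: "1 - b < d" "c < 1 - a"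
      using s t st by linarith+
    show ?thesis
      using gap_unique [OF I' J *] by auto
  qed simp
  show ?thesis
  proof (cases "b \<le> c")
    case False
    then have eq: "c = a" "d = b"
      using L by auto
    show ?thesis
    proof (cases "0 \<le> a")
      case False
      then have "a = - b"
        using B eq by (elim disjE conjE) linarith+
      then have ab: "a < 0" "0 < b"
        using gI(1) by linarith+
      then have "even N"
        using gI(4) odd_intercept by blast
      then show ?thesis
        by (simp add: corner_cells_def eq lo_hi [OF I ab])
    next
      case a: True
      show ?thesis
      proof (cases "b \<le> 1 / 2")
        case False
        then have "a = 1 - b"
          using T eq by (elim disjE conjE) linarith+
        then have "a < 1 / 2" "1 / 2 < b"
          using gI(1) by linarith+
        then show ?thesis
          by (simp add: corner_cells_def eq lo_hi [OF I])
      next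
        case b: True
        \<comment> \<open>Otherwise \<open>a + \<alpha>\<close> and \<open>b - \<alpha>\<close> both
          lie inside the gap, so \<open>a\<close> has the last and \<open>b\<close> the first index
          and \<open>a + b\<close> is an integer.\<close>
        have "b \<le> a + \<alpha>"
        proof (rule ccontr)
          assume "\<not> b \<le> a + \<alpha>"
          then have "a + \<alpha> \<notin> intercepts" "b - \<alpha> \<notin> intercepts"
            using gI(4) [of "a + \<alpha>"] gI(4) [of "b - \<alpha>"] slope_pos by auto
          then obtain m n where "a = pt (int N - 1) m" "b = pt 0 n"
            using leaving_intercepts [OF gI(2)] entering_intercepts [OF gI(3)] by metis
          then have "a + b = of_int (m + n)"
            by (simp only: pt_first_last)
          moreover have "0 \<le> a + a" "b + b \<le> 1"
            using a b by auto
          ultimately show False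
            using symmetric_gaps_outside [OF I I] by blast
        qed
        then show ?thesis
          using ccell_left_wall [of b a] a b eq by auto
      qed
    qed
  next
    case bc: True
    show ?thesis
    proof (cases "d \<le> a + \<alpha>")
      case R: True
      show ?thesis
      proof (cases "0 \<le> a + c")
        case False
        then have "c = - b" "d = - a"
          using B by blast+
        then show ?thesis
          using ccell_floor [of b a] bc R gap_le_1 [OF I] by auto
      next
        case ac: True
        show ?thesis
        proof (cases "b + d \<le> 1")
          case False
          then have "c = 1 - b" "d = 1 - a"
            using T by blast+
          then show ?thesis
            using ccell_ceiling [of b a] bc R gap_le_1 [OF I] by auto
        next
          case True
          then show ?thesis
            using ccell_parallelogram [OF bc R ac] ccell_parallelogram' [OF bc R ac] by blast
        qed
      qed
    next
      case R: False
      show ?thesis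
      proof (cases "0 \<le> a + c")
        case False
        then have eq: "c = - b" "d = - a"
          using B by blast+
        then have cd: "c < \<alpha> / 2" "\<alpha> / 2 < d"
          using R s t st by linarith+
        then have "odd N"
          using gJ(4) even_intercept by blast
        moreover have "a = - d" "b = - c"
          using eq by auto
        ultimately show ?thesis
          by (simp add: corner_cells_def lo_hi [OF J cd])
      next
        case ac: True
        show ?thesis
        proof (cases "b + d \<le> 1")
          case False
          then have eq: "c = 1 - b" "d = 1 - a"
            using T by blast+
          then have "2 * c < 1 + \<alpha>" "1 + \<alpha> < 2 * d"
            using R s t st by linarith+
          then have cd: "c < (1 + \<alpha>) / 2" "(1 + \<alpha>) / 2 < d"
            by simp_all
          moreover have "a = 1 - d" "b = 1 - c"
            using eq by auto
          ultimately show ?thesis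
            by (simp add: corner_cells_def lo_hi [OF J cd])
        next
          case True
          then show ?thesis
            using right_wall_cells [OF I J bc ac True] R s t st by auto
        qed
      qed
    qed
  qed
qed

end

section \<open>The cells are the pieces\<close>

text \<open>One list of representatives carries both bounds at once, in a form that isometries of
  the square preserve.\<close>

definition few_shapes :: "(real \<times> real) set set \<Rightarrow> bool" where
  "few_shapes \<P> \<longleftrightarrow> (\<exists>R. length R \<le> 16 \<and> (\<forall>r\<in>set R. compact r) \<and>
     card (measure lebesgue ` set R) \<le> 13 \<and> (\<forall>P\<in>\<P>. \<exists>r\<in>set R. same_shape r P))"

lemma few_shapes_counts:
  assumes "few_shapes \<P>"
  shows "card (measure lebesgue ` \<P>) \<le> 13" "card (\<P> // {(P, Q). same_shape P Q}) \<le> 16"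
proof -
  obtain R where R: "length R \<le> 16" "\<forall>r\<in>set R. compact r" "card (measure lebesgue ` set R) \<le> 13"
    and rep: "\<And>P. P \<in> \<P> \<Longrightarrow> \<exists>r\<in>set R. same_shape r P"
    using assms unfolding few_shapes_def by blast
  have "measure lebesgue ` \<P> \<subseteq> measure lebesgue ` set R"
  proof
    fix y assume "y \<in> measure lebesgue ` \<P>"
    then obtain P where P: "P \<in> \<P>" "y = measure lebesgue P"
      by blast
    then obtain r where "r \<in> set R" "same_shape r P"
      using rep by blast
    then show "y \<in> measure lebesgue ` set R"
      using P R(2) same_shape_measure by (intro image_eqI [of _ _ r]) auto
  qed
  then have "card (measure lebesgue ` \<P>) \<le> card (measure lebesgue ` set R)"
    by (intro card_mono) auto
  then show "card (measure lebesgue ` \<P>) \<le> 13"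
    using R(3) by simp
  let ?r = "{(P, Q). same_shape P Q}"
  have "\<P> // ?r \<subseteq> (\<lambda>r. ?r `` {r}) ` set R"
  proof
    fix X assume "X \<in> \<P> // ?r"
    then obtain P where P: "P \<in> \<P>" "X = ?r `` {P}"
      by (auto simp: quotient_def)
    then obtain r where "r \<in> set R" "same_shape r P"
      using rep by blast
    moreover have "?r `` {P} = ?r `` {r}"
      using \<open>same_shape r P\<close> by (auto intro: same_shape_trans same_shape_sym)
    ultimately show "X \<in> (\<lambda>r. ?r `` {r}) ` set R"
      using P by blast
  qed
  then have "card (\<P> // ?r) \<le> card ((\<lambda>r. ?r `` {r}) ` set R)"
    by (intro card_mono) auto
  also have "\<dots> \<le> length R"
    using card_image_le card_length le_trans by blast
  finally show "card (\<P> // ?r) \<le> 16"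
    using R(1) by simp
qed

lemma (in square_isometry) few_shapes_image:
  assumes "few_shapes \<P>"
  shows "few_shapes (image h ` \<P>)"
proof -
  have "\<exists>r\<in>S. same_shape r (h ` P)" if "\<exists>r\<in>S. same_shape r P" for S P
    using that same_shape_trans [OF _ same_shape_image] by blast
  then show ?thesis
    using assms unfolding few_shapes_def ball_simps by metis
qed

section \<open>Open cells, their closures and their representatives\<close>

context orbit_lines
begin

definition lines :: "(real \<times> real) set" where
  "lines = {(u, v). (u, v) \<in> square \<and> (v - \<alpha> * u \<in> intercepts \<or> v + \<alpha> * u \<in> intercepts)}"

definition window :: "real \<Rightarrow> real \<Rightarrow> real \<Rightarrow> real \<Rightarrow> (real \<times> real) set" where
  "window a b c d = {(u, v). a < v - \<alpha> * u \<and> v - \<alpha> * u < b \<and> c < v + \<alpha> * u \<and> v + \<alpha> * u < d}"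

definition cells :: "(real \<times> real) set set" where
  "cells = {square \<inter> window a b c d | a b c d. gap a b \<and> gap c d \<and> square \<inter> window a b c d \<noteq> {}}"

lemma open_window: "open (window a b c d)"
  unfolding window_def case_prod_unfold
  by (intro open_Collect_conj open_Collect_less continuous_intros)

lemma convex_window: "convex (window a b c d)"
proof -
  have "window a b c d = {z. (- \<alpha>, 1) \<bullet> z > a} \<inter> {z. (- \<alpha>, 1) \<bullet> z < b} \<inter>
      {z. (\<alpha>, 1) \<bullet> z > c} \<inter> {z. (\<alpha>, 1) \<bullet> z < d}"
    by (auto simp: window_def)
  then show ?thesis
    by (simp add: convex_Int convex_halfspace_lt convex_halfspace_gt)
qed

lemma ccell_eq_Int: "ccell a b c d = square \<inter> ({z. (- \<alpha>, 1) \<bullet> z \<ge> a} \<inter> {z. (- \<alpha>, 1) \<bullet> z \<le> b} \<inter>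
      {z. (\<alpha>, 1) \<bullet> z \<ge> c} \<inter> {z. (\<alpha>, 1) \<bullet> z \<le> d})"
  by (auto simp: ccell_def)

lemma polytope_ccell: "polytope (ccell a b c d)"
  unfolding polytope_eq_bounded_polyhedron ccell_eq_Int square_eq_cbox
  by (intro conjI polyhedron_Int polyhedron_halfspace_le polyhedron_halfspace_ge bounded_Int
      disjI1 polytope_imp_polyhedron polytope_interval bounded_cbox)

lemma compact_ccell: "compact (ccell a b c d)"
  by (simp add: polytope_ccell polytope_imp_compact)

text \<open>The segment from any point of the closed cell to a point of the open one satisfies the
  strict inequalities immediately after its start.\<close>

lemma closure_cell:
  assumes "square \<inter> window a b c d \<noteq> {}"
  shows "closure (square \<inter> window a b c d) = ccell a b c d"
proof
  show "closure (square \<inter> window a b c d) \<subseteq> ccell a b c d"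
    by (intro closure_minimal compact_imp_closed compact_ccell) (auto simp: window_def ccell_def)
  obtain z where z: "z \<in> square \<inter> window a b c d"
    using assms by blast
  show "ccell a b c d \<subseteq> closure (square \<inter> window a b c d)"
  proof
    fix w assume w: "w \<in> ccell a b c d"
    let ?f = "\<lambda>n. w + (1 / real (Suc n)) *\<^sub>R (z - w)"
    have "?f n \<in> square \<inter> window a b c d" for n
    proof
      define q where "q = 1 / real (Suc n)"
      have t: "0 < q" "q \<le> 1"
        by (auto simp: q_def)
      have eq: "?f n = (1 - q) *\<^sub>R w + q *\<^sub>R z"
        unfolding q_def [symmetric] by (simp add: algebra_simps)
      have "convex square"
        by (simp add: square_eq_cbox)
      then show "?f n \<in> square"
        unfolding eq using w z t by (intro convexD) (auto simp: ccell_def)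
      obtain u v u' v' where uv: "w = (u, v)" "z = (u', v')"
        by fastforce
      have lin: "p * (x + q * (x' - x)) + (y + q * (y' - y)) = (1 - q) * (p * x + y) + q * (p * x' + y')"
        for p x x' y y' :: real
        by (simp add: algebra_simps)
      have less: "r < (1 - q) * x + q * y" if "r \<le> x" "r < y" for r x y :: real
      proof -
        have "(1 - q) * r + q * r < (1 - q) * x + q * y"
          using t that by (intro add_le_less_mono mult_left_mono mult_strict_left_mono) auto
        then show ?thesis
          by (simp add: algebra_simps)
      qed
      have gr: "(1 - q) * x + q * y < r" if "x \<le> r" "y < r" for r x y :: real
        using less [of "- r" "- x" "- y"] that by simp
      have "a < - \<alpha> * (u + q * (u' - u)) + (v + q * (v' - v))"
        "- \<alpha> * (u + q * (u' - u)) + (v + q * (v' - v)) < b"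
        "c < \<alpha> * (u + q * (u' - u)) + (v + q * (v' - v))"
        "\<alpha> * (u + q * (u' - u)) + (v + q * (v' - v)) < d"
        unfolding lin using w z uv by (auto simp: ccell_def window_def intro!: less gr)
      then show "?f n \<in> window a b c d"
        unfolding q_def [symmetric] by (simp add: uv window_def add.commute)
    qed
    moreover have "?f \<longlonglongrightarrow> w + 0 *\<^sub>R (z - w)"
      by (intro tendsto_intros LIMSEQ_Suc lim_1_over_n [unfolded of_nat_Suc])
    then have "?f \<longlonglongrightarrow> w"
      by simp
    ultimately show "w \<in> closure (square \<inter> window a b c d)"
      unfolding closure_sequential by (intro exI [of _ ?f]) simp
  qed
qed

text \<open>The window is open and the open square is dense in the square, so a nonempty cell has a
  point off all four walls; this supplies the strict inequalities of
  \<open>cell_shapes\<close>.\<close>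

lemma cell_interior_point:
  assumes "square \<inter> window a b c d \<noteq> {}"
  obtains s t where "a < s" "s < b" "c < t" "t < d" "s < t" "t < s + \<alpha>" "0 < s + t" "s + t < 1"
proof -
  have "box (0, 0) (1 / 2 :: real, 1 / 2 :: real) \<noteq> {}"
    by (simp add: box_ne_empty Basis_prod_def)
  then have "closure (box (0, 0) (1 / 2, 1 / 2)) \<inter> window a b c d \<noteq> {}"
    using assms by (simp add: closure_box square_eq_cbox)
  then have "box (0, 0) (1 / 2, 1 / 2) \<inter> window a b c d \<noteq> {}"
    using open_Int_closure_eq_empty [OF open_window] by (metis Int_commute)
  then obtain u v where uv: "0 < u" "u < 1 / 2" "0 < v" "v < 1 / 2" "(u, v) \<in> window a b c d"
    by (auto simp: Basis_prod_def mem_box)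
  then have "0 < \<alpha> * u" "2 * (\<alpha> * u) < \<alpha>"
    using slope_pos by auto
  then show ?thesis
    using uv by (intro that [of "v - \<alpha> * u" "v + \<alpha> * u"]) (auto simp: window_def)
qed

lemma disjoint_cells: "pairwise disjnt cells"
proof (rule pairwiseI)
  fix X Y assume "X \<in> cells" "Y \<in> cells" "X \<noteq> Y"
  then obtain a b c d a' b' c' d' where X: "X = square \<inter> window a b c d" "gap a b" "gap c d"
    and Y: "Y = square \<inter> window a' b' c' d'" "gap a' b'" "gap c' d'"
    unfolding cells_def by blast
  show "disjnt X Y"
  proof (rule ccontr)
    assume "\<not> disjnt X Y"
    then obtain u v where "(u, v) \<in> window a b c d" "(u, v) \<in> window a' b' c' d'"
      using X Y by (auto simp: disjnt_def)
    then have "a < b'" "a' < b" "c < d'" "c' < d"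
      by (auto simp: window_def)
    then have "a = a'" "b = b'" "c = c'" "d = d'"
      using gap_unique [OF X(2) Y(2)] gap_unique [OF X(3) Y(3)] by auto
    then show False
      using \<open>X \<noteq> Y\<close> X Y by simp
  qed
qed

lemma Union_cells: "\<Union>cells = square - lines"
proof (intro set_eqI iffI)
  fix z assume "z \<in> \<Union>cells"
  then show "z \<in> square - lines"
    by (auto simp: cells_def window_def lines_def gapD)
next
  fix z assume z: "z \<in> square - lines"
  obtain u v where uv: "z = (u, v)"
    by fastforce
  then have "v - \<alpha> * u \<notin> intercepts" "v + \<alpha> * u \<notin> intercepts"
    using z by (auto simp: lines_def)
  then obtain a b c d where "gap a b" "a < v - \<alpha> * u" "v - \<alpha> * u < b" "gap c d" "c < v + \<alpha> * u" "v + \<alpha> * u < d"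
    by (metis gap_exists)
  moreover from this have "z \<in> square \<inter> window a b c d"
    using z uv by (auto simp: window_def)
  ultimately show "z \<in> \<Union>cells"
    unfolding cells_def by blast
qed

lemma intercept_range:
  assumes "(u, v) \<in> square"
  shows "- \<alpha> \<le> v - \<alpha> * u" "v - \<alpha> * u \<le> 1" "- \<alpha> \<le> v + \<alpha> * u" "v + \<alpha> * u \<le> \<alpha> + 1"
proof -
  have "0 \<le> \<alpha> * u" "2 * (\<alpha> * u) \<le> \<alpha>" "0 \<le> v" "v \<le> 1 / 2"
    using assms scale_iffs [of u] by (simp_all add: square_def)
  then show "- \<alpha> \<le> v - \<alpha> * u" "v - \<alpha> * u \<le> 1" "- \<alpha> \<le> v + \<alpha> * u" "v + \<alpha> * u \<le> \<alpha> + 1"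
    using slope_pos by linarith+
qed

lemma finite_cells: "finite cells"
proof -
  \<comment> \<open>The range of both coordinates on the square, widened by \<open>1\<close> on
    either side because a gap is at most that long.\<close>
  let ?F = "intercepts \<inter> {- \<alpha> - 1..\<alpha> + 2}"
  have "cells \<subseteq> (\<lambda>(a, b, c, d). square \<inter> window a b c d) ` (?F \<times> ?F \<times> ?F \<times> ?F)"
  proof
    fix X assume "X \<in> cells"
    then obtain a b c d where X: "X = square \<inter> window a b c d" "gap a b" "gap c d" "X \<noteq> {}"
      unfolding cells_def by blast
    then obtain u v where "(u, v) \<in> square" "(u, v) \<in> window a b c d"
      by auto
    then have "a \<in> ?F" "b \<in> ?F" "c \<in> ?F" "d \<in> ?F"
      using intercept_range [of u v] gap_le_1 [OF X(2)] gap_le_1 [OF X(3)] gapD(1-3) [OF X(2)]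
        gapD(1-3) [OF X(3)] slope_pos by (auto simp: window_def)
    then show "X \<in> (\<lambda>(a, b, c, d). square \<inter> window a b c d) ` (?F \<times> ?F \<times> ?F \<times> ?F)"
      using X(1) by (intro image_eqI [of _ _ "(a, b, c, d)"]) auto
  qed
  then show ?thesis
    by (rule finite_subset) (intro finite_imageI finite_cartesian_product finite_intercepts)
qed

lemma negligible_lines: "negligible lines"
proof -
  let ?F = "intercepts \<inter> {- \<alpha>..\<alpha> + 1}"
  have "negligible (\<Union>p\<in>?F. {z :: real \<times> real. (- \<alpha>, 1) \<bullet> z = p} \<union> {z. (\<alpha>, 1) \<bullet> z = p})"
    using finite_intercepts by (auto intro!: negligible_Union negligible_Un negligible_hyperplane simp: zero_prod_def)
  moreover have "lines \<subseteq> (\<Union>p\<in>?F. {z. (- \<alpha>, 1) \<bullet> z = p} \<union> {z. (\<alpha>, 1) \<bullet> z = p})"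
  proof
    fix z assume z: "z \<in> lines"
    obtain u v where uv: "z = (u, v)"
      by fastforce
    have sq: "(u, v) \<in> square"
      using z uv by (auto simp: lines_def)
    have "v - \<alpha> * u \<in> ?F \<or> v + \<alpha> * u \<in> ?F"
      using z uv intercept_range [OF sq] slope_pos by (auto simp: lines_def)
    then show "z \<in> (\<Union>p\<in>?F. {z. (- \<alpha>, 1) \<bullet> z = p} \<union> {z. (\<alpha>, 1) \<bullet> z = p})"
    proof
      assume "v - \<alpha> * u \<in> ?F"
      then show ?thesis
        unfolding uv by (rule UN_I) simp
    next
      assume "v + \<alpha> * u \<in> ?F"
      then show ?thesis
        unfolding uv by (rule UN_I) simp
    qed
  qed
  ultimately show ?thesis
    using negligible_subset by blast
qed

lemma lines_partition:
  "pieces_of lines = closure ` cells" "polygonal_partition (pieces_of lines) square"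
proof -
  have cell: "convex C \<and> C \<noteq> {} \<and> polytope (closure C) \<and> (\<exists>U. open U \<and> C = square \<inter> U)"
    if cells: "C \<in> cells" for C
  proof -
    obtain a b c d where C: "C = square \<inter> window a b c d" "C \<noteq> {}"
      using cells unfolding cells_def by blast
    have "convex C"
      unfolding C(1) square_eq_cbox by (intro convex_Int convex_box convex_window)
    moreover have "polytope (closure C)"
      using C closure_cell polytope_ccell by simp
    ultimately show ?thesis
      using C open_window by blast
  qed
  note * = polygonal_partition_cells [OF finite_cells disjoint_cells Union_cells cell negligible_lines]
  then show "pieces_of lines = closure ` cells"
    by (simp add: pieces_of_def)
  then show "polygonal_partition (pieces_of lines) square"
    using * by simp
qed

lemma ccell_in_pieces:
  assumes "gap a b" "gap c d" "square \<inter> window a b c d \<noteq> {}"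
  shows "ccell a b c d \<in> pieces_of lines"
  using assms closure_cell unfolding lines_partition(1) cells_def by blast

lemma lines_few_shapes: "few_shapes (pieces_of lines)"
proof -
  obtain k\<^sub>1 k\<^sub>2 k\<^sub>3 where k: "\<And>a b. gap a b \<Longrightarrow> b - a \<in> {k\<^sub>1, k\<^sub>2, k\<^sub>3}"
    using three_gaps by blast
  \<comment> \<open>A candidate length that no gap attains is arbitrary and may be negative;
    absolute values make the area formulas applicable and do not change true lengths.\<close>
  define l\<^sub>1 l\<^sub>2 l\<^sub>3 where l: "l\<^sub>1 = \<bar>k\<^sub>1\<bar>" "l\<^sub>2 = \<bar>k\<^sub>2\<bar>" "l\<^sub>3 = \<bar>k\<^sub>3\<bar>"
  have gap: "b - a \<in> {l\<^sub>1, l\<^sub>2, l\<^sub>3}" if "gap a b" for a b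
    using k [OF that] gapD(1) [OF that] by (auto simp: l)
  have nn: "0 \<le> l\<^sub>1" "0 \<le> l\<^sub>2" "0 \<le> l\<^sub>3"
    by (simp_all add: l)
  let ?par = "parallelogram \<alpha>" and ?wall = "wall_triangle \<alpha>" and ?floor = "floor_triangle \<alpha>"
  \<comment> \<open>These 13 sets exhaust the areas; the floor triangles are added only as shapes.
    Corner cells represent themselves, since for wide gaps a further wall may cut them and they need
    not be triangles.\<close>
  let ?A = "[?par l\<^sub>1 l\<^sub>1, ?par l\<^sub>1 l\<^sub>2, ?par l\<^sub>1 l\<^sub>3, ?par l\<^sub>2 l\<^sub>2, ?par l\<^sub>2 l\<^sub>3, ?par l\<^sub>3 l\<^sub>3,
    ?wall l\<^sub>1, ?wall l\<^sub>2, ?wall l\<^sub>3, cut_triangle] @ corner_cells"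
  let ?R = "[?floor l\<^sub>1, ?floor l\<^sub>2, ?floor l\<^sub>3] @ ?A"
  have "length ?R \<le> 16"
    by (simp add: corner_cells_def)
  moreover have "\<forall>r\<in>set ?R. compact r"
    using compact_parallelogram [OF slope_pos] compact_shapes [OF slope_pos]
    by (auto simp: corner_cells_def compact_ccell cut_triangle_def)
  moreover have "card (measure lebesgue ` set ?R) \<le> 13"
  proof -
    have fw: "measure lebesgue (?floor l) = measure lebesgue (?wall l)" if "0 \<le> l" for l
      using that slope_pos by (simp add: measure_floor_triangle measure_wall_triangle)
    have "measure lebesgue ` set ?R = measure lebesgue ` set ?A"
      by (auto simp: fw nn)
    moreover have "card (measure lebesgue ` set ?A) \<le> length ?A"
      by (rule le_trans [OF card_image_le [OF List.finite_set] card_length])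
    moreover have "length ?A = 13"
      by (simp add: corner_cells_def)
    ultimately show ?thesis
      by (simp only:)
  qed
  moreover have "\<exists>r\<in>set ?R. same_shape r P" if P: "P \<in> pieces_of lines" for P
  proof -
    obtain a b c d where g: "gap a b" "gap c d" and ne: "square \<inter> window a b c d \<noteq> {}"
      and "P = closure (square \<inter> window a b c d)"
      using P unfolding lines_partition(1) cells_def by blast
    then have P: "P = ccell a b c d"
      using closure_cell by simp
    obtain s t where "a < s" "s < b" "c < t" "t < d" "s < t" "t < s + \<alpha>" "0 < s + t" "s + t < 1"
      using cell_interior_point [OF ne] by blast
    from cell_shapes [OF g this]
    consider "same_shape (?par (b - a) (d - c)) P" "same_shape (?par (d - c) (b - a)) P"
      | "same_shape (?wall (b - a)) P" | "same_shape (?wall (d - c)) P"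
      | "same_shape (?floor (b - a)) P" | "same_shape cut_triangle P" | "P \<in> set corner_cells"
      unfolding P by blast
    then show ?thesis
      using gap [OF g(1)] gap [OF g(2)] same_shape_refl [of P] by cases auto
  qed
  ultimately show ?thesis
    unfolding few_shapes_def by blast
qed

end

section \<open>Distance to the nearest integer and membership in the orbit\<close>

lemma dist_int_le_half: "dist_int x \<le> 1 / 2"
  using of_int_round_abs_le [of x] by (simp add: dist_int_def abs_minus_commute)

lemma dist_int_cases: "\<exists>n. x = of_int n + dist_int x \<or> x = of_int n - dist_int x"
  by (rule exI [of _ "round x"]) (auto simp: dist_int_def)

lemma dist_int_eqI:
  assumes "x = of_int n + u \<or> x = of_int n - u" "0 \<le> u" "u \<le> 1 / 2"
  shows "dist_int x = u"
proof (cases "round x = n")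
  case True
  then show ?thesis
    using assms by (auto simp: dist_int_def)
next
  case False
  then have "1 \<le> \<bar>round x - n\<bar>"
    by linarith
  then have "1 \<le> \<bar>of_int (round x) - of_int n :: real\<bar>"
    by (simp flip: of_int_diff of_int_abs)
  moreover have "\<bar>x - of_int (round x)\<bar> \<le> \<bar>x - of_int n\<bar>"
    by (rule round_diff_minimal)
  moreover have "\<bar>x - of_int n\<bar> = u"
    using assms by auto
  ultimately show ?thesis
    using assms(3) unfolding dist_int_def by linarith
qed

lemma orbit_iff:
  "(u, v) \<in> orbit \<alpha> M \<longleftrightarrow> (u, v) \<in> square \<and>
    (\<exists>x n m. 0 \<le> x \<and> x \<le> M \<and> (x = of_int n + u \<or> x = of_int n - u) \<and>
      (\<alpha> * x = of_int m + v \<or> \<alpha> * x = of_int m - v))"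
  (is "_ \<longleftrightarrow> ?rhs")
proof
  assume "(u, v) \<in> orbit \<alpha> M"
  then obtain x where x: "0 \<le> x" "x \<le> M" "u = dist_int x" "v = dist_int (\<alpha> * x)"
    by (auto simp: orbit_def orbit_point_def)
  have "(u, v) \<in> square"
    using x dist_int_le_half by (auto simp: square_def dist_int_def)
  then show ?rhs
    using x dist_int_cases [of x] dist_int_cases [of "\<alpha> * x"] by blast
next
  assume ?rhs
  then obtain x n m where x: "0 \<le> x" "x \<le> M" "x = of_int n + u \<or> x = of_int n - u"
      "\<alpha> * x = of_int m + v \<or> \<alpha> * x = of_int m - v" and sq: "(u, v) \<in> square"
    by blast
  have "dist_int x = u" "dist_int (\<alpha> * x) = v"
    using x sq by (auto intro!: dist_int_eqI simp: square_def)
  then show "(u, v) \<in> orbit \<alpha> M"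
    using x by (auto simp: orbit_def orbit_point_def intro!: image_eqI [of _ _ x])
qed

section \<open>Unfolding the orbit\<close>

lemma (in orbit_lines) intercepts_odd:
  assumes "N = 2 * h + 1"
  shows "x \<in> intercepts \<longleftrightarrow> (\<exists>j m. \<bar>j\<bar> \<le> int h \<and> x = of_int j * \<alpha> + of_int m)"
proof -
  have pt: "pt k m = of_int (k - int h) * \<alpha> + of_int m" for k m
    unfolding pt_def using assms by simp
  have k: "0 \<le> k \<and> k < int N \<longleftrightarrow> \<bar>k - int h\<bar> \<le> int h" for k
    using assms by auto
  have "x \<in> intercepts \<longleftrightarrow> (\<exists>k m. \<bar>k - int h\<bar> \<le> int h \<and> x = of_int (k - int h) * \<alpha> + of_int m)"
    unfolding intercepts_def mem_Collect_eq pt k by blast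
  then show ?thesis
    by (metis add_diff_cancel_right')
qed

lemma (in orbit_lines) intercepts_even:
  assumes "N = 2 * h"
  shows "x + \<alpha> / 2 \<in> intercepts \<longleftrightarrow> (\<exists>j m. - int h \<le> j \<and> j < int h \<and> x = of_int j * \<alpha> + of_int m)"
proof -
  have pt: "pt k m = of_int (k - int h) * \<alpha> + \<alpha> / 2 + of_int m" for k m
    unfolding pt_def using assms by (simp add: field_simps)
  have k: "0 \<le> k \<and> k < int N \<longleftrightarrow> - int h \<le> k - int h \<and> k - int h < int h" for k
    using assms by auto
  have eq: "x + \<alpha> / 2 = y + \<alpha> / 2 + z \<longleftrightarrow> x = y + z" for y z
    by auto
  have "x + \<alpha> / 2 \<in> intercepts \<longleftrightarrow>
      (\<exists>k m. - int h \<le> k - int h \<and> k - int h < int h \<and> x = of_int (k - int h) * \<alpha> + of_int m)"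
    unfolding intercepts_def mem_Collect_eq pt k eq by blast
  then show ?thesis
    by (metis add_diff_cancel_right')
qed

text \<open>Write the time as \<open>n \<plusminus> u\<close> and its multiple by \<alpha> as
  \<open>m \<plusminus> v\<close>. Equal signs put the point on a rising line, opposite signs on a
  falling one, with intercept an integer plus \<open>n * \<alpha>\<close> or its negative.\<close>

lemma (in orbit_lines) orbit_odd:
  assumes N: "N = 2 * h + 1"
  shows "orbit \<alpha> (N / 2) = lines"
proof (intro set_eqI iffI)
  have half: "real N / 2 = real h + 1 / 2"
    using N by simp
  fix z assume "z \<in> orbit \<alpha> (N / 2)"
  moreover obtain u v where z: "z = (u, v)"
    by fastforce
  ultimately obtain x n m where sq: "(u, v) \<in> square" and x: "0 \<le> x" "x \<le> h + 1 / 2"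
    and n: "x = of_int n + u \<or> x = of_int n - u" and m: "\<alpha> * x = of_int m + v \<or> \<alpha> * x = of_int m - v"
    unfolding z orbit_iff half by blast
  have uv: "0 \<le> u" "u \<le> 1 / 2"
    using sq by (auto simp: square_def)
  have "\<exists>n. \<bar>n\<bar> \<le> int h \<and> (x = of_int n + u \<or> x = of_int n - u)"
  proof (cases "x = of_int n + u \<or> n \<le> int h")
    case True
    then have "- 1 < n" "n \<le> int h"
      using n x uv by linarith+
    then show ?thesis
      using n by (intro exI [of _ n]) auto
  next
    case False
    \<comment> \<open>Only the end time \<open>h + 1/2\<close> allows \<open>n = h + 1\<close>;
      there \<open>u = 1/2\<close>, and the same time is also \<open>h + u\<close>.\<close>
    then have "x = of_int n - u" "n = int h + 1" "u = 1 / 2"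
      using n x uv by linarith+
    then have "x = of_int (int h) + u"
      by simp
    then show ?thesis
      by (intro exI [of _ "int h"]) simp
  qed
  then obtain n where n: "\<bar>n\<bar> \<le> int h" and "x = of_int n + u \<or> x = of_int n - u"
    by blast
  then consider "v - \<alpha> * u = of_int n * \<alpha> + of_int (- m)" | "v + \<alpha> * u = of_int (- n) * \<alpha> + of_int m"
    | "v + \<alpha> * u = of_int n * \<alpha> + of_int (- m)" | "v - \<alpha> * u = of_int (- n) * \<alpha> + of_int m"
    using m by (fastforce simp: algebra_simps)
  then show "z \<in> lines"
    using sq n unfolding z lines_def mem_Collect_eq split_conv intercepts_odd [OF N]
    by cases (metis abs_minus_cancel)+
next
  have half: "real N / 2 = real h + 1 / 2"
    using N by simp
  fix z assume z: "z \<in> lines"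
  obtain u v where zuv: "z = (u, v)"
    by fastforce
  have sq: "(u, v) \<in> square" and uv: "0 \<le> u" "u \<le> 1 / 2"
    using z zuv by (auto simp: lines_def square_def)
  have goal: "z \<in> orbit \<alpha> (N / 2)" if "0 \<le> x" "x \<le> h + 1 / 2" "x = of_int n + u \<or> x = of_int n - u"
    "\<alpha> * x = of_int m + v \<or> \<alpha> * x = of_int m - v" for x n m
    using that sq unfolding zuv orbit_iff half by blast
  have h: "0 \<le> of_int j + u" "of_int j + u \<le> h + 1 / 2" if "0 \<le> j" "j \<le> int h" for j
    using that uv by linarith+
  have h': "0 \<le> of_int j - u" "of_int j - u \<le> h + 1 / 2" if "0 < j" "j \<le> int h" for j
    using that uv by linarith+
  consider j m where "\<bar>j\<bar> \<le> int h" "v - \<alpha> * u = of_int j * \<alpha> + of_int m"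
    | j m where "\<bar>j\<bar> \<le> int h" "v + \<alpha> * u = of_int j * \<alpha> + of_int m"
    using z unfolding zuv lines_def mem_Collect_eq split_conv intercepts_odd [OF N] by blast
  then show "z \<in> orbit \<alpha> (N / 2)"
  proof cases
    case (1 j m)
    show ?thesis
    proof (cases "0 \<le> j")
      case True
      then show ?thesis
        using 1 h [of j] by (intro goal [of "of_int j + u" j "- m"]) (auto simp: algebra_simps)
    next
      case False
      then show ?thesis
        using 1 h' [of "- j"] by (intro goal [of "of_int (- j) - u" "- j" m]) (auto simp: algebra_simps)
    qed
  next
    case (2 j m)
    show ?thesis
    \<comment> \<open>The coefficient \<open>0\<close> must go to the other case, since
      \<open>0 - u\<close> would be a negative time.\<close>
    proof (cases "0 < j")
      case True
      then show ?thesis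
        using 2 h' [of j] by (intro goal [of "of_int j - u" j "- m"]) (auto simp: algebra_simps)
    next
      case False
      then show ?thesis
        using 2 h [of "- j"] by (intro goal [of "of_int (- j) + u" "- j" m]) (auto simp: algebra_simps)
    qed
  qed
qed

text \<open>Replacing \<open>u\<close> by \<open>1/2 - u\<close> exchanges rising and falling lines
  and moves intercepts by \<open>\<alpha> / 2\<close>, which turns half-odd multiples of \<alpha>
  into integer ones. The range of \<open>j\<close> is lopsided because the last stretch has times
  \<open>h - u\<close> but never \<open>h + u\<close> with \<open>u > 0\<close>.\<close>

lemma (in orbit_lines) flip_lines_iff:
  assumes N: "N = 2 * h"
  shows "(u, v) \<in> (\<lambda>(u, v). (1 / 2 - u, v)) ` lines \<longleftrightarrow> (u, v) \<in> square \<and>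
    (\<exists>j m. - int h \<le> j \<and> j < int h \<and>
      (v - \<alpha> * u = of_int j * \<alpha> + of_int m \<or> v + \<alpha> * u = of_int (- j) * \<alpha> + of_int m))"
proof -
  have "(u, v) \<in> (\<lambda>(u, v). (1 / 2 - u, v)) ` lines \<longleftrightarrow> (1 / 2 - u, v) \<in> lines"
    by (force intro: rev_image_eqI)
  also have "\<dots> \<longleftrightarrow> (u, v) \<in> square \<and> (- (v + \<alpha> * u) + \<alpha> / 2 \<in> intercepts \<or> (v - \<alpha> * u) + \<alpha> / 2 \<in> intercepts)"
    using intercepts_uminus [of "v + \<alpha> * u - \<alpha> / 2"]
    by (auto simp: lines_def square_def algebra_simps)
  also have "(- (v + \<alpha> * u) + \<alpha> / 2 \<in> intercepts) \<longleftrightarrow>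
      (\<exists>j m. - int h \<le> j \<and> j < int h \<and> v + \<alpha> * u = of_int (- j) * \<alpha> + of_int m)"
    (is "_ \<longleftrightarrow> ?R")
  proof -
    have "- (v + \<alpha> * u) = of_int j * \<alpha> + of_int m \<longleftrightarrow> v + \<alpha> * u = of_int (- j) * \<alpha> + of_int (- m)" for j m
      by auto
    then show ?thesis
      unfolding intercepts_even [OF N] by (metis add.inverse_inverse)
  qed
  finally show ?thesis
    unfolding intercepts_even [OF N] by blast
qed

lemma (in orbit_lines) orbit_even:
  assumes N: "N = 2 * h"
  shows "orbit \<alpha> (N / 2) = (\<lambda>(u, v). (1 / 2 - u, v)) ` lines"
proof (intro set_eqI iffI)
  have half: "real N / 2 = real h"
    using N by simp
  have h_pos: "0 < int h"
    using N N_pos by simp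
  fix z assume "z \<in> orbit \<alpha> (N / 2)"
  moreover obtain u v where z: "z = (u, v)"
    by fastforce
  ultimately obtain x n m where sq: "(u, v) \<in> square" and x: "0 \<le> x" "x \<le> real h"
    and n: "x = of_int n + u \<or> x = of_int n - u" and m: "\<alpha> * x = of_int m + v \<or> \<alpha> * x = of_int m - v"
    unfolding z orbit_iff half by blast
  have uv: "0 \<le> u" "u \<le> 1 / 2"
    using sq by (auto simp: square_def)
  have "\<exists>n. (- int h \<le> n \<and> n < int h \<and> x = of_int n + u) \<or> (- int h \<le> - n \<and> - n < int h \<and> x = of_int n - u)"
  proof (cases "x = of_int n + u")
    case True
    show ?thesis
    proof (cases "n < int h")
      case False
      \<comment> \<open>The coefficient \<open>h\<close> with sign \<open>+\<close> occurs only at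
        the end time, where \<open>u = 0\<close> and the sign can be changed.\<close>
      then have "n = int h" "x = of_int n - u"
        using True x uv by linarith+
      then show ?thesis
        using h_pos by (intro exI [of _ n]) auto
    next
      case n: True
      have "- 1 < n"
        using True x uv by linarith
      then show ?thesis
        using n True by (intro exI [of _ n]) auto
    qed
  next
    case False
    then have "x = of_int n - u" "- 1 < n" "n < int h + 1"
      using n x uv by linarith+
    then show ?thesis
      using h_pos by (intro exI [of _ n]) auto
  qed
  then obtain n where "(- int h \<le> n \<and> n < int h \<and> x = of_int n + u) \<or> (- int h \<le> - n \<and> - n < int h \<and> x = of_int n - u)"
    by blast
  then consider "- int h \<le> n" "n < int h" "v - \<alpha> * u = of_int n * \<alpha> + of_int (- m)"
    | "- int h \<le> n" "n < int h" "v + \<alpha> * u = of_int (- n) * \<alpha> + of_int m"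
    | "- int h \<le> - n" "- n < int h" "v + \<alpha> * u = of_int (- (- n)) * \<alpha> + of_int (- m)"
    | "- int h \<le> - n" "- n < int h" "v - \<alpha> * u = of_int (- n) * \<alpha> + of_int m"
    using m by (fastforce simp: algebra_simps)
  then show "z \<in> (\<lambda>(u, v). (1 / 2 - u, v)) ` lines"
    unfolding z flip_lines_iff [OF N] using sq by cases blast+
next
  have half: "real N / 2 = real h"
    using N by simp
  fix z assume z: "z \<in> (\<lambda>(u, v). (1 / 2 - u, v)) ` lines"
  obtain u v where zuv: "z = (u, v)"
    by fastforce
  have sq: "(u, v) \<in> square" and uv: "0 \<le> u" "u \<le> 1 / 2"
    using z unfolding zuv flip_lines_iff [OF N] by (auto simp: square_def)
  have goal: "z \<in> orbit \<alpha> (N / 2)" if "0 \<le> x" "x \<le> real h" "x = of_int n + u \<or> x = of_int n - u"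
    "\<alpha> * x = of_int m + v \<or> \<alpha> * x = of_int m - v" for x n m
    using that sq unfolding zuv orbit_iff half by blast
  have h: "0 \<le> of_int j + u" "of_int j + u \<le> h" if "0 \<le> j" "j < int h" for j
    using that uv by linarith+
  have h': "0 \<le> of_int j - u" "of_int j - u \<le> h" if "0 < j" "j \<le> int h" for j
    using that uv by linarith+
  consider j m where "- int h \<le> j" "j < int h" "v - \<alpha> * u = of_int j * \<alpha> + of_int m"
    | j m where "- int h \<le> j" "j < int h" "v + \<alpha> * u = of_int (- j) * \<alpha> + of_int m"
    using z unfolding zuv flip_lines_iff [OF N] by blast
  then show "z \<in> orbit \<alpha> (N / 2)"
  proof cases
    case (1 j m)
    show ?thesis
    proof (cases "0 \<le> j")
      case True
      then show ?thesis
        using 1 h [of j] by (intro goal [of "of_int j + u" j "- m"]) (auto simp: algebra_simps)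
    next
      case False
      then show ?thesis
        using 1 h' [of "- j"] by (intro goal [of "of_int (- j) - u" "- j" m]) (auto simp: algebra_simps)
    qed
  next
    case (2 j m)
    show ?thesis
    proof (cases "0 \<le> j")
      case True
      then show ?thesis
        using 2 h [of j] by (intro goal [of "of_int j + u" j m]) (auto simp: algebra_simps)
    next
      case False
      then show ?thesis
        using 2 h' [of "- j"] by (intro goal [of "of_int (- j) - u" "- j" "- m"]) (auto simp: algebra_simps)
    qed
  qed
qed

lemma pieces_eq_pieces_of: "pieces \<alpha> M = pieces_of (orbit \<alpha> M)"
  by (simp add: pieces_def pieces_of_def)

lemma half_integer_end:
  assumes "0 < \<alpha>" "0 < N"
  shows "polygonal_partition (pieces \<alpha> (real N / 2)) square \<and> few_shapes (pieces \<alpha> (real N / 2))"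
proof -
  interpret orbit_lines \<alpha> N
    using assms by unfold_locales
  interpret flip: square_isometry "\<lambda>(u, v). (- u, v)" "(1 / 2, 0)" "\<lambda>(u, v). (1 / 2 - u, v)"
    by (rule square_isometry_flip)
  show ?thesis
  proof (cases "even N")
    case True
    then obtain h where "N = 2 * h"
      by blast
    from orbit_even [OF this] show ?thesis
      using flip.polygonal_partition_image [OF lines_partition(2)] flip.few_shapes_image [OF lines_few_shapes]
      by (simp add: pieces_eq_pieces_of flip.pieces_of_image)
  next
    case False
    then obtain h where "N = 2 * h + 1"
      using oddE by blast
    from orbit_odd [OF this] show ?thesis
      using lines_partition(2) lines_few_shapes by (simp add: pieces_eq_pieces_of)
  qed
qed

text \<open>Measuring time by the second coordinate multiplies it by \<alpha> and inverts the
  slope.\<close>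

lemma orbit_swap:
  assumes "0 < \<alpha>"
  shows "orbit \<alpha> M = prod.swap ` orbit (1 / \<alpha>) (\<alpha> * M)"
proof -
  have *: "{0..\<alpha> * M} = (\<lambda>x. \<alpha> * x) ` {0..M}"
    using assms by simp
  show ?thesis
    unfolding orbit_def * image_image using assms by (intro image_cong) (auto simp: orbit_point_def)
qed

lemma half_integer_of_dist_int:
  assumes "dist_int x = 0 \<or> dist_int x = 1 / 2" "0 < x"
  obtains N :: nat where "0 < N" "x = real N / 2"
proof -
  obtain n where "x = of_int n + dist_int x \<or> x = of_int n - dist_int x"
    using dist_int_cases by blast
  then have "\<exists>k :: int. 2 * x = of_int k"
    using assms(1) by (auto intro: exI [of _ "2 * n"] exI [of _ "2 * n + 1"] exI [of _ "2 * n - 1"])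
  then obtain k :: int where k: "2 * x = of_int k"
    by blast
  then have "0 < k"
    using assms(2) by (metis mult_pos_pos of_int_0_less_iff zero_less_numeral)
  then show ?thesis
    using k by (intro that [of "nat k"]) auto
qed

lemma ends_on_boundary_partition:
  assumes "0 < \<alpha>" "0 < M" "ends_on_boundary \<alpha> M"
  shows "polygonal_partition (pieces \<alpha> M) square \<and> few_shapes (pieces \<alpha> M)"
proof -
  interpret swap: square_isometry prod.swap "(0, 0)" prod.swap
    by (rule square_isometry_swap)
  have nn: "0 \<le> dist_int x" for x
    by (simp add: dist_int_def)
  have "(dist_int M = 0 \<or> dist_int M = 1 / 2) \<or> (dist_int (\<alpha> * M) = 0 \<or> dist_int (\<alpha> * M) = 1 / 2)"
    using assms(3) nn [of M] nn [of "\<alpha> * M"] dist_int_le_half [of M] dist_int_le_half [of "\<alpha> * M"]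
    by (auto simp: ends_on_boundary_def orbit_point_def)
  then show ?thesis
  proof
    assume "dist_int M = 0 \<or> dist_int M = 1 / 2"
    then obtain N :: nat where "0 < N" "M = real N / 2"
      using half_integer_of_dist_int assms(2) by blast
    then show ?thesis
      using half_integer_end [OF assms(1)] by blast
  next
    assume "dist_int (\<alpha> * M) = 0 \<or> dist_int (\<alpha> * M) = 1 / 2"
    moreover have "0 < \<alpha> * M"
      using assms by simp
    ultimately obtain N :: nat where "0 < N" "\<alpha> * M = real N / 2"
      using half_integer_of_dist_int by blast
    moreover have "0 < 1 / \<alpha>"
      using assms(1) by simp
    ultimately have "polygonal_partition (pieces (1 / \<alpha>) (\<alpha> * M)) square \<and> few_shapes (pieces (1 / \<alpha>) (\<alpha> * M))"
      using half_integer_end by metis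
    then show ?thesis
      using swap.polygonal_partition_image swap.few_shapes_image
      by (simp add: pieces_eq_pieces_of orbit_swap [OF assms(1)] swap.pieces_of_image)
  qed
qed

section \<open>The extremal example\<close>

context orbit_lines
begin

lemma ccell_top_left_corner:
  assumes "a + b = 1" "0 \<le> a" "b \<le> a + \<alpha>"
  shows "same_shape (corner_triangle \<alpha> (b - a)) (ccell a b a b)"
proof (rule same_shapeI [of 1 "- 1" _ 0 "1 / 2"])
  fix u v
  show "(u, v) \<in> ccell a b a b \<longleftrightarrow> (1 * (u - 0), - 1 * (v - 1 / 2)) \<in> corner_triangle \<alpha> (b - a)"
    unfolding ccell_iff corner_triangle_def mem_Collect_eq split_conv mult_1 diff_0_right scale_iffs(1) [of u]
    using assms by (auto simp: field_simps)
qed auto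

lemma ccell_bottom_right_corner:
  assumes "c + d = \<alpha>" "0 \<le> c" "d \<le> c + 1"
  shows "same_shape (corner_triangle \<alpha> (d - c)) (ccell (- d) (- c) c d)"
proof (rule same_shapeI [of "- 1" 1 _ "1 / 2" 0])
  fix u v
  show "(u, v) \<in> ccell (- d) (- c) c d \<longleftrightarrow> (- 1 * (u - 1 / 2), 1 * (v - 0)) \<in> corner_triangle \<alpha> (d - c)"
    unfolding ccell_iff corner_triangle_def mem_Collect_eq split_conv scale_right scale_right_iff mult_1 diff_0_right
    using assms by (auto simp: field_simps)
qed auto

lemma ccell_top_right_corner:
  assumes "c + d = 1 + \<alpha>" "d \<le> c + 1" "d \<le> c + \<alpha>"
  shows "same_shape (corner_triangle \<alpha> (d - c)) (ccell (1 - d) (1 - c) c d)"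
proof (rule same_shapeI [of "- 1" "- 1" _ "1 / 2" "1 / 2"])
  fix u v
  show "(u, v) \<in> ccell (1 - d) (1 - c) c d \<longleftrightarrow>
      (- 1 * (u - 1 / 2), - 1 * (v - 1 / 2)) \<in> corner_triangle \<alpha> (d - c)"
    unfolding ccell_iff corner_triangle_def mem_Collect_eq split_conv scale_right scale_right_iff [of u]
    using assms by (auto simp: field_simps)
qed auto

text \<open>The inequalities for the walls are not strict: the witness may lie on the boundary of
  the square, as it does for many of the cells below.\<close>

lemma ccell_in_piecesI:
  assumes "gap a b" "gap c d" "a < s" "s < b" "c < t" "t < d" "s \<le> t" "t \<le> s + \<alpha>" "0 \<le> s + t" "s + t \<le> 1"
  shows "ccell a b c d \<in> pieces_of lines"
proof (rule ccell_in_pieces [OF assms(1,2)])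
  have "\<alpha> * ((t - s) / 2 / \<alpha>) = (t - s) / 2"
    using slope_pos by simp
  then have "((t - s) / 2 / \<alpha>, (s + t) / 2) \<in> square \<inter> window a b c d"
    using assms(3-) slope_pos by (auto simp: square_def window_def field_simps)
  then show "square \<inter> window a b c d \<noteq> {}"
    by blast
qed

end

section \<open>Wall and floor triangles told apart by diameter\<close>

lemma diameter_wall_triangle:
  assumes "0 < \<alpha>" "0 \<le> x"
  shows "x \<le> diameter (wall_triangle \<alpha> x)"
proof -
  have "(0, 0) \<in> wall_triangle \<alpha> x" "(0, x) \<in> wall_triangle \<alpha> x"
    using assms by (auto simp: wall_triangle_def)
  then have "dist (0, 0) (0 :: real, x) \<le> diameter (wall_triangle \<alpha> x)"
    by (rule diameter_bounded_bound [OF compact_imp_bounded [OF compact_shapes(1) [OF assms(1)]]])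
  then show ?thesis
    using assms by (simp add: dist_Pair_Pair dist_real_def)
qed

text \<open>The triangle fits in a box of width \<open>6/7 * x\<close> and height
  \<open>x / 2\<close>. The squared diagonal is \<open>193/196 * x\<^sup>2\<close>, and
  \<open>200/201\<close> is merely a rational below \<open>1\<close> whose square exceeds
  \<open>193/196\<close>.\<close>

lemma diameter_floor_triangle:
  assumes "7 / 6 \<le> \<alpha>" "0 < x"
  shows "diameter (floor_triangle \<alpha> x) < x"
proof -
  have "norm (p - q) \<le> 200 / 201 * x" if "p \<in> floor_triangle \<alpha> x" "q \<in> floor_triangle \<alpha> x" for p q
  proof -
    obtain u v u' v' where pq: "p = (u, v)" "q = (u', v')"
      by fastforce
    have ineq: "0 \<le> v" "v \<le> \<alpha> * u" "v + \<alpha> * u \<le> x" "0 \<le> v'" "v' \<le> \<alpha> * u'" "v' + \<alpha> * u' \<le> x"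
      using that by (simp_all add: pq floor_triangle_def)
    then have "\<bar>\<alpha> * u - \<alpha> * u'\<bar> \<le> x"
      by linarith
    moreover have "2 * v \<le> x" "2 * v' \<le> x"
      using ineq(2,3,5,6) by linarith+
    then have v: "\<bar>v - v'\<bar> \<le> 1 / 2 * x"
      using ineq(1,4) by (simp add: abs_if)
    ultimately have "\<alpha> * \<bar>u - u'\<bar> \<le> x"
      using assms by (simp add: abs_mult flip: right_diff_distrib)
    moreover have "7 / 6 * \<bar>u - u'\<bar> \<le> \<alpha> * \<bar>u - u'\<bar>"
      using assms by (intro mult_right_mono) auto
    ultimately have "7 / 6 * \<bar>u - u'\<bar> \<le> x"
      by (meson order_trans)
    then have u: "\<bar>u - u'\<bar> \<le> 6 / 7 * x"
      by simp
    have "(u - u')\<^sup>2 \<le> (6 / 7 * x)\<^sup>2" "(v - v')\<^sup>2 \<le> (1 / 2 * x)\<^sup>2"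
      using u v assms by (simp_all add: abs_le_square_iff [symmetric] abs_mult)
    then have "(u - u')\<^sup>2 + (v - v')\<^sup>2 \<le> (6 / 7 * x)\<^sup>2 + (1 / 2 * x)\<^sup>2"
      by (rule add_mono)
    also have "\<dots> \<le> (200 / 201 * x)\<^sup>2"
      by (simp add: power_mult_distrib power_divide)
    finally have "sqrt ((u - u')\<^sup>2 + (v - v')\<^sup>2) \<le> 200 / 201 * x"
      using assms by (intro real_le_lsqrt) auto
    then show ?thesis
      by (simp add: pq norm_Pair)
  qed
  then have "diameter (floor_triangle \<alpha> x) \<le> 200 / 201 * x"
    using assms by (intro diameter_le) auto
  then show ?thesis
    using assms by simp
qed

text \<open>Modulo 22 the numerators of the intercepts are 0, 5, 7, 10, 12, 15, 17. The corner
  points \<open>1/2\<close>, \<open>\<alpha> / 2\<close> and \<open>(1 + \<alpha>) / 2\<close> fall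
  into gaps of lengths 2, 3 and 5 over 22, so the three corner triangles differ.\<close>

interpretation ex: orbit_lines "27 / 22" 7
  by unfold_locales auto

text \<open>For fixed \<open>k\<close>, the least number above \<open>a\<close> congruent to
  \<open>27 * k\<close> modulo 22 is \<open>a + 1 + (27 * k - a - 1) mod 22\<close>. The last
  hypothesis says that it is never below \<open>b\<close>, a finite check.\<close>

lemma ex_gap:
  assumes "a = 27 * i + 22 * m" "\<bar>i\<bar> \<le> 3" "b = 27 * j + 22 * n" "\<bar>j\<bar> \<le> 3" "a < b"
    and "\<forall>k\<in>{- 3, - 2, - 1, 0, 1, 2, 3}. b - a - 1 \<le> (27 * k - a - 1) mod 22"
  shows "ex.gap (of_int a / 22) (of_int b / 22)"
proof -
  have ints: "x \<in> ex.intercepts \<longleftrightarrow> (\<exists>k l. \<bar>k\<bar> \<le> 3 \<and> x = of_int (27 * k + 22 * l) / 22)" for x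
    using ex.intercepts_odd [of 3 x] by (simp add: field_simps)
  have "x \<notin> ex.intercepts" if x: "of_int a / 22 < x" "x < of_int b / 22" for x
  proof
    assume "x \<in> ex.intercepts"
    then obtain k l where kl: "\<bar>k\<bar> \<le> 3" "x = of_int (27 * k + 22 * l) / 22"
      unfolding ints by blast
    then have "(of_int a :: real) < of_int (27 * k + 22 * l)" "(of_int (27 * k + 22 * l) :: real) < of_int b"
      using x by (simp_all add: field_simps)
    then have ab: "a < 27 * k + 22 * l" "27 * k + 22 * l < b"
      by (simp_all only: of_int_less_iff)
    have "k \<in> {- 3, - 2, - 1, 0, 1, 2, 3}"
      using kl(1) by auto
    then have "b - a - 1 \<le> (27 * k - a - 1) mod 22"
      using assms(6) by blast
    also have "(27 * k - a - 1) mod 22 = (27 * k + 22 * l - a - 1) mod 22"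
      by (metis add_diff_eq add.commute mod_mult_self2 diff_diff_eq)
    also have "\<dots> \<le> 27 * k + 22 * l - a - 1"
      using ab(1) by (intro zmod_le_nonneg_dividend) simp
    finally show False
      using ab(2) by simp
  qed
  moreover have "of_int a / 22 \<in> ex.intercepts" "of_int b / 22 \<in> ex.intercepts"
    unfolding ints using assms(1-4) by blast+
  ultimately show ?thesis
    using assms(5) by (auto simp: ex.gap_def)
qed

definition ex_gaps :: "(int \<times> int) set" where
  "ex_gaps = {(- 15, - 12), (- 10, - 7), (- 7, - 5), (- 5, 0), (0, 5), (5, 7),
    (7, 10), (10, 12), (12, 15), (17, 22), (22, 27)}"

lemma ex_gaps_gap:
  assumes "(a, b) \<in> ex_gaps"
  shows "ex.gap (of_int a / 22) (of_int b / 22)"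
proof -
  have "ex.gap (of_int (- 15) / 22) (of_int (- 12) / 22)"
    by (rule ex_gap [of _ "- 3" "3" _ "2" "- 3"]) simp_all
  moreover
  have "ex.gap (of_int (- 10) / 22) (of_int (- 7) / 22)"
    by (rule ex_gap [of _ "- 2" "2" _ "3" "- 4"]) simp_all
  moreover
  have "ex.gap (of_int (- 7) / 22) (of_int (- 5) / 22)"
    by (rule ex_gap [of _ "3" "- 4" _ "- 1" "1"]) simp_all
  moreover
  have "ex.gap (of_int (- 5) / 22) (of_int (0) / 22)"
    by (rule ex_gap [of _ "- 1" "1" _ "0" "0"]) simp_all
  moreover
  have "ex.gap (of_int (0) / 22) (of_int (5) / 22)"
    by (rule ex_gap [of _ "0" "0" _ "1" "- 1"]) simp_all
  moreover
  have "ex.gap (of_int (5) / 22) (of_int (7) / 22)"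
    by (rule ex_gap [of _ "1" "- 1" _ "- 3" "4"]) simp_all
  moreover
  have "ex.gap (of_int (7) / 22) (of_int (10) / 22)"
    by (rule ex_gap [of _ "- 3" "4" _ "2" "- 2"]) simp_all
  moreover
  have "ex.gap (of_int (10) / 22) (of_int (12) / 22)"
    by (rule ex_gap [of _ "2" "- 2" _ "- 2" "3"]) simp_all
  moreover
  have "ex.gap (of_int (12) / 22) (of_int (15) / 22)"
    by (rule ex_gap [of _ "- 2" "3" _ "3" "- 3"]) simp_all
  moreover
  have "ex.gap (of_int (17) / 22) (of_int (22) / 22)"
    by (rule ex_gap [of _ "- 1" "2" _ "0" "1"]) simp_all
  moreover
  have "ex.gap (of_int (22) / 22) (of_int (27) / 22)"
    by (rule ex_gap [of _ "0" "1" _ "1" "0"]) simp_all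
  ultimately show ?thesis
    using assms unfolding ex_gaps_def by blast
qed

lemma (in orbit_lines) shape_in_pieces:
  assumes "same_shape S (ccell a b c d)" "gap a b" "gap c d"
    and "a < s" "s < b" "c < t" "t < d" "s \<le> t" "t \<le> s + \<alpha>" "0 \<le> s + t" "s + t \<le> 1"
  shows "\<exists>P\<in>pieces_of lines. same_shape S P"
  using assms(1) ccell_in_piecesI [OF assms(2-)] by blast

text \<open>The witness is given by numerators over 44, so that midpoints of gaps are integers too;
  in this unit \<alpha> is 54 and \<open>1\<close> is 44.\<close>

lemma ex_shape:
  assumes "(a, b) \<in> ex_gaps" "(c, d) \<in> ex_gaps"
    and "2 * a < s" "s < 2 * b" "2 * c < t" "t < 2 * d" "s \<le> t" "t \<le> s + 54" "0 \<le> s + t" "s + t \<le> 44"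
    and "same_shape S (ex.ccell (of_int a / 22) (of_int b / 22) (of_int c / 22) (of_int d / 22))"
  shows "\<exists>P\<in>pieces_of ex.lines. same_shape S P"
proof (rule ex.shape_in_pieces [OF assms(11) ex_gaps_gap ex_gaps_gap, of "of_int s / 44" "of_int t / 44"])
  have "(of_int (2 * a) :: real) < of_int s" "(of_int s :: real) < of_int (2 * b)"
    "(of_int (2 * c) :: real) < of_int t" "(of_int t :: real) < of_int (2 * d)"
    "(of_int s :: real) \<le> of_int t" "(of_int t :: real) \<le> of_int (s + 54)"
    "(0 :: real) \<le> of_int (s + t)" "(of_int (s + t) :: real) \<le> of_int 44"
    using assms(3-10) by (simp_all only: of_int_less_iff of_int_le_iff of_int_0_le_iff)
  then show "real_of_int a / 22 < of_int s / 44" "of_int s / 44 < real_of_int b / 22"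
    "real_of_int c / 22 < of_int t / 44" "of_int t / 44 < real_of_int d / 22"
    "real_of_int s / 44 \<le> of_int t / 44" "real_of_int t / 44 \<le> of_int s / 44 + 27 / 22"
    "0 \<le> real_of_int s / 44 + of_int t / 44" "real_of_int s / 44 + of_int t / 44 \<le> 1"
    by simp_all
qed (use assms in auto)

definition ex_areas :: "(real \<times> real) set list" where
  "ex_areas =
    [corner_triangle (27 / 22) (1 / 11),
     corner_triangle (27 / 22) (3 / 22),
     corner_triangle (27 / 22) (5 / 22),
     wall_triangle (27 / 22) (1 / 11),
     wall_triangle (27 / 22) (3 / 22),
     wall_triangle (27 / 22) (5 / 22),
     trapezoid (27 / 22) (5 / 22) (1 / 11),
     parallelogram (27 / 22) (1 / 11) (1 / 11),
     parallelogram (27 / 22) (3 / 22) (1 / 11),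
     parallelogram (27 / 22) (3 / 22) (3 / 22),
     parallelogram (27 / 22) (5 / 22) (1 / 11),
     parallelogram (27 / 22) (5 / 22) (3 / 22),
     parallelogram (27 / 22) (5 / 22) (5 / 22)]"

definition ex_floors :: "(real \<times> real) set list" where
  "ex_floors = [floor_triangle (27 / 22) (1 / 11), floor_triangle (27 / 22) (3 / 22), floor_triangle (27 / 22) (5 / 22)]"

lemma ex_shapes_in_pieces:
  assumes "S \<in> set (ex_areas @ ex_floors)"
  shows "\<exists>P\<in>pieces_of ex.lines. same_shape S P"
proof -
  have "\<exists>P\<in>pieces_of ex.lines. same_shape (corner_triangle (27 / 22) (1 / 11)) P"
    by (rule ex_shape [of "10" "12" "10" "12" "21" "22"])
      (use ex.ccell_top_left_corner [of "10 / 22" "12 / 22"] in \<open>simp_all add: ex_gaps_def\<close>)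
  moreover
  have "\<exists>P\<in>pieces_of ex.lines. same_shape (corner_triangle (27 / 22) (3 / 22)) P"
    by (rule ex_shape [of "- 15" "- 12" "12" "15" "- 27" "27"])
      (use ex.ccell_bottom_right_corner [of "12 / 22" "15 / 22"] in \<open>simp_all add: ex_gaps_def\<close>)
  moreover
  have "\<exists>P\<in>pieces_of ex.lines. same_shape (corner_triangle (27 / 22) (5 / 22)) P"
    by (rule ex_shape [of "- 5" "0" "22" "27" "- 5" "49"])
      (use ex.ccell_top_right_corner [of 1 "27 / 22"] in \<open>simp_all add: ex_gaps_def\<close>)
  moreover
  have "\<exists>P\<in>pieces_of ex.lines. same_shape (wall_triangle (27 / 22) (1 / 11)) P"
    by (rule ex_shape [of "5" "7" "5" "7" "12" "12"])
      (use ex.ccell_left_wall [of "7 / 22" "5 / 22"] in \<open>simp_all add: ex_gaps_def\<close>)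
  moreover
  have "\<exists>P\<in>pieces_of ex.lines. same_shape (wall_triangle (27 / 22) (3 / 22)) P"
    by (rule ex_shape [of "7" "10" "7" "10" "17" "17"])
      (use ex.ccell_left_wall [of "10 / 22" "7 / 22"] in \<open>simp_all add: ex_gaps_def\<close>)
  moreover
  have "\<exists>P\<in>pieces_of ex.lines. same_shape (wall_triangle (27 / 22) (5 / 22)) P"
    by (rule ex_shape [of "0" "5" "0" "5" "5" "5"])
      (use ex.ccell_left_wall [of "5 / 22" "0 / 22"] in \<open>simp_all add: ex_gaps_def\<close>)
  moreover
  \<comment> \<open>The intercept \<open>- 7 / 22\<close> has the last index, and its translate
    \<open>20 / 22\<close> lies inside the gap from \<open>17 / 22\<close> to
    \<open>22 / 22\<close>; the remaining width is \<open>2 / 22\<close>.\<close>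
  have "\<exists>P\<in>pieces_of ex.lines. same_shape (trapezoid (27 / 22) (5 / 22) (1 / 11)) P"
    by (rule ex_shape [of "- 7" "- 5" "17" "22" "- 12" "39"])
      (use ex.ccell_trapezoid_below [of "- 5 / 22" "17 / 22" "- 7 / 22" "22 / 22"] in \<open>simp_all add: ex_gaps_def\<close>)
  moreover
  have "\<exists>P\<in>pieces_of ex.lines. same_shape (parallelogram (27 / 22) (1 / 11) (1 / 11)) P"
    by (rule ex_shape [of "- 7" "- 5" "10" "12" "- 12" "22"])
      (use ex.ccell_parallelogram [of "- 5 / 22" "10 / 22" "12 / 22" "- 7 / 22"] in \<open>simp_all add: ex_gaps_def\<close>)
  moreover
  have "\<exists>P\<in>pieces_of ex.lines. same_shape (parallelogram (27 / 22) (3 / 22) (1 / 11)) P"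
    by (rule ex_shape [of "7" "10" "10" "12" "17" "22"])
      (use ex.ccell_parallelogram [of "10 / 22" "10 / 22" "12 / 22" "7 / 22"] in \<open>simp_all add: ex_gaps_def\<close>)
  moreover
  have "\<exists>P\<in>pieces_of ex.lines. same_shape (parallelogram (27 / 22) (3 / 22) (3 / 22)) P"
    by (rule ex_shape [of "- 10" "- 7" "12" "15" "- 17" "27"])
      (use ex.ccell_parallelogram [of "- 7 / 22" "12 / 22" "15 / 22" "- 10 / 22"] in \<open>simp_all add: ex_gaps_def\<close>)
  moreover
  have "\<exists>P\<in>pieces_of ex.lines. same_shape (parallelogram (27 / 22) (5 / 22) (1 / 11)) P"
    by (rule ex_shape [of "0" "5" "5" "7" "5" "12"])
      (use ex.ccell_parallelogram [of "5 / 22" "5 / 22" "7 / 22" "0 / 22"] in \<open>simp_all add: ex_gaps_def\<close>)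
  moreover
  have "\<exists>P\<in>pieces_of ex.lines. same_shape (parallelogram (27 / 22) (5 / 22) (3 / 22)) P"
    by (rule ex_shape [of "0" "5" "12" "15" "5" "27"])
      (use ex.ccell_parallelogram [of "5 / 22" "12 / 22" "15 / 22" "0 / 22"] in \<open>simp_all add: ex_gaps_def\<close>)
  moreover
  have "\<exists>P\<in>pieces_of ex.lines. same_shape (parallelogram (27 / 22) (5 / 22) (5 / 22)) P"
    by (rule ex_shape [of "- 5" "0" "17" "22" "- 5" "39"])
      (use ex.ccell_parallelogram [of "0 / 22" "17 / 22" "22 / 22" "- 5 / 22"] in \<open>simp_all add: ex_gaps_def\<close>)
  moreover
  have "\<exists>P\<in>pieces_of ex.lines. same_shape (floor_triangle (27 / 22) (1 / 11)) P"
    by (rule ex_shape [of "- 7" "- 5" "5" "7" "- 12" "12"])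
      (use ex.ccell_floor [of "- 5 / 22" "- 7 / 22"] in \<open>simp_all add: ex_gaps_def\<close>)
  moreover
  have "\<exists>P\<in>pieces_of ex.lines. same_shape (floor_triangle (27 / 22) (3 / 22)) P"
    by (rule ex_shape [of "- 10" "- 7" "7" "10" "- 17" "17"])
      (use ex.ccell_floor [of "- 7 / 22" "- 10 / 22"] in \<open>simp_all add: ex_gaps_def\<close>)
  moreover
  have "\<exists>P\<in>pieces_of ex.lines. same_shape (floor_triangle (27 / 22) (5 / 22)) P"
    by (rule ex_shape [of "- 5" "0" "0" "5" "- 5" "5"])
      (use ex.ccell_floor [of "0 / 22" "- 5 / 22"] in \<open>simp_all add: ex_gaps_def\<close>)
  ultimately show ?thesis
    using assms unfolding ex_areas_def ex_floors_def by (simp only: set_append set_simps Un_iff insert_iff empty_iff) blast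
qed

text \<open>The denominator is \<open>22\<^sup>2 * 8 * \<alpha>\<close>. Over it, gap lengths
  \<open>p / 22\<close> and \<open>q / 22\<close> give \<open>p\<^sup>2\<close> for corners,
  \<open>2 * p\<^sup>2\<close> for walls, \<open>4 * p * q\<close> for parallelograms and
  \<open>2 * (25 - 9)\<close> for the trapezoid.\<close>

lemma ex_measures:
  "map (measure lebesgue) ex_areas =
    map (\<lambda>n. n / 4752) [4, 9, 25, 8, 18, 50, 32, 16, 24, 36, 40, 60, 100]"
  by (simp add: ex_areas_def measure_corner_triangle measure_wall_triangle measure_trapezoid
      measure_parallelogram power2_eq_square)

lemma ex_compact: "S \<in> set (ex_areas @ ex_floors) \<Longrightarrow> compact S"
  by (auto simp: ex_areas_def ex_floors_def compact_shapes compact_parallelogram)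

lemma ex_pieces: "pieces (27 / 22) (7 / 2) = pieces_of ex.lines"
  using ex.orbit_odd [of 3] by (simp add: pieces_eq_pieces_of)

lemma ex_ends_on_boundary: "ends_on_boundary (27 / 22) (7 / 2)"
proof -
  have "dist_int (7 / 2) = 1 / 2"
    by (rule dist_int_eqI [of _ 3]) auto
  moreover have "0 \<le> dist_int (27 / 22 * (7 / 2))"
    by (simp add: dist_int_def)
  ultimately show ?thesis
    using dist_int_le_half by (auto simp: ends_on_boundary_def orbit_point_def square_def)
qed

lemma ex_areas_subset: "measure lebesgue ` set ex_areas \<subseteq> measure lebesgue ` pieces_of ex.lines"
proof
  fix y assume "y \<in> measure lebesgue ` set ex_areas"
  then obtain S where S: "S \<in> set (ex_areas @ ex_floors)" "y = measure lebesgue S"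
    by auto
  then obtain P where "P \<in> pieces_of ex.lines" "same_shape S P"
    using ex_shapes_in_pieces by blast
  then show "y \<in> measure lebesgue ` pieces_of ex.lines"
    using S same_shape_measure ex_compact by (intro image_eqI [of _ _ P]) auto
qed

lemma ex_finite: "finite (pieces_of ex.lines)"
  using ex.lines_partition(2) by (simp add: polygonal_partition_def)

lemma ex_num_areas: "13 \<le> num_areas (27 / 22) (7 / 2)"
proof -
  have "card (measure lebesgue ` set ex_areas) = card (set (map (measure lebesgue) ex_areas))"
    by simp
  also have "\<dots> = 13"
    unfolding ex_measures by (subst distinct_card) simp_all
  finally show ?thesis
    unfolding num_areas_def ex_pieces using card_mono [OF _ ex_areas_subset] ex_finite by simp
qed

text \<open>Vertical and horizontal triangles over the same gap have equal area; since \<open>\<alpha> > 1\<close>, the vertical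
  ones have the larger diameter.\<close>

definition area_diameter :: "(real \<times> real) set \<Rightarrow> real \<times> real" where
  "area_diameter P = (measure lebesgue P, diameter P)"

lemma same_shape_area_diameter:
  "same_shape P Q \<Longrightarrow> compact P \<Longrightarrow> area_diameter P = area_diameter Q"
  by (simp add: area_diameter_def same_shape_measure same_shape_diameter)

text \<open>The pair of area and diameter is constant on every congruence class. A class may contain
  sets outside the partition, but any chosen member has the same invariant.\<close>

lemma card_shapes_ge:
  assumes "finite \<P>" "\<And>P. P \<in> \<P> \<Longrightarrow> compact P"
  shows "card (area_diameter ` \<P>) \<le> card (\<P> // {(P, Q). same_shape P Q})"
proof -
  let ?r = "{(P, Q). same_shape P Q}"
  have fin: "finite (\<P> // ?r)"
    using assms(1) by (simp add: quotient_def)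
  have "area_diameter ` \<P> \<subseteq> (\<lambda>X. area_diameter (SOME Q. Q \<in> X)) ` (\<P> // ?r)"
  proof
    fix y assume "y \<in> area_diameter ` \<P>"
    then obtain P where P: "P \<in> \<P>" "y = area_diameter P"
      by blast
    have "(SOME Q. Q \<in> ?r `` {P}) \<in> ?r `` {P}"
      by (rule someI [of _ P]) (simp add: same_shape_refl)
    then have "area_diameter (SOME Q. Q \<in> ?r `` {P}) = y"
      using same_shape_area_diameter assms(2) P by auto
    moreover have "?r `` {P} \<in> \<P> // ?r"
      using P(1) by (rule quotientI)
    ultimately show "y \<in> (\<lambda>X. area_diameter (SOME Q. Q \<in> X)) ` (\<P> // ?r)"
      by blast
  qed
  then show ?thesis
    using fin surj_card_le by blast
qed

lemma ex_num_shapes: "16 \<le> num_shapes (27 / 22) (7 / 2)"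
proof -
  let ?K = "pieces_of ex.lines" and ?L = "ex_areas @ ex_floors"
  have comp: "compact P" if "P \<in> ?K" for P
    using that ex.lines_partition(2) by (auto simp: polygonal_partition_def polygon_def polytope_imp_compact)
  have sub: "area_diameter ` set ?L \<subseteq> area_diameter ` ?K"
  proof
    fix y assume "y \<in> area_diameter ` set ?L"
    then obtain S where S: "S \<in> set ?L" "y = area_diameter S"
      by blast
    then obtain P where "P \<in> ?K" "same_shape S P"
      using ex_shapes_in_pieces by blast
    then show "y \<in> area_diameter ` ?K"
      using S same_shape_area_diameter ex_compact by (intro image_eqI [of _ _ P]) auto
  qed
  have diam: "diameter (wall_triangle (27 / 22) x) \<noteq> diameter (floor_triangle (27 / 22) x)" if "0 < x" for x
    using diameter_wall_triangle [of "27 / 22" x] diameter_floor_triangle [of "27 / 22" x] that by simp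
  have "distinct (map area_diameter ?L)"
    using diam [of "1 / 11"] diam [of "3 / 22"] diam [of "5 / 22"]
    by (simp add: ex_areas_def ex_floors_def area_diameter_def measure_corner_triangle
        measure_wall_triangle measure_floor_triangle measure_trapezoid measure_parallelogram power2_eq_square)
  then have "card (set (map area_diameter ?L)) = 16"
    by (subst distinct_card) (simp_all add: ex_areas_def ex_floors_def)
  then have "16 \<le> card (area_diameter ` ?K)"
    using card_mono [OF finite_imageI [OF ex_finite] sub] by (simp only: set_map)
  then show ?thesis
    unfolding num_shapes_def ex_pieces using card_shapes_ge [OF ex_finite comp] by linarith
qed

theorem theorem2:
  shows "(\<forall>\<alpha>>0. \<forall>M>0. ends_on_boundary \<alpha> M \<longrightarrow>
            polygonal_partition (pieces \<alpha> M) square \<and>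
            num_areas \<alpha> M \<le> 13 \<and> num_shapes \<alpha> M \<le> 16)
       \<and> (\<exists>\<alpha>>0. \<exists>M>0. ends_on_boundary \<alpha> M \<and> num_areas \<alpha> M = 13)
       \<and> (\<exists>\<alpha>>0. \<exists>M>0. ends_on_boundary \<alpha> M \<and> num_shapes \<alpha> M = 16)"
proof -
  have bounds: "polygonal_partition (pieces \<alpha> M) square \<and> num_areas \<alpha> M \<le> 13 \<and> num_shapes \<alpha> M \<le> 16"
    if "0 < \<alpha>" "0 < M" "ends_on_boundary \<alpha> M" for \<alpha> M
    using ends_on_boundary_partition [OF that] few_shapes_counts
    unfolding num_areas_def num_shapes_def by blast
  have "num_areas (27 / 22) (7 / 2) = 13" "num_shapes (27 / 22) (7 / 2) = 16"
    using bounds [OF _ _ ex_ends_on_boundary] ex_num_areas ex_num_shapes by auto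
  moreover have "(0 :: real) < 27 / 22" "(0 :: real) < 7 / 2"
    by simp_all
  ultimately show ?thesis
    using bounds ex_ends_on_boundary by blast
qed

end
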